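(* Let $\Phi,\varphi:[0,\infty)\to[0,\infty)$ be convex self-homeomorphisms with $\Phi(1)=\varphi(1)=1$ for which there exist $R>1$ and $n_0\in\mathbf N$, $n_0\ge1$, such that $$\Phi(x)\Phi(y)\le\Phi(R^2xy)\ \ (x,y\ge1),\qquad \frac{\varphi(R^k)}{\varphi(R^{k+1})}\le\frac{\varphi(R^{k-1})}{\varphi(R^k)}\ \ (k\in\mathbf N,\ k\ge1),\qquad \sum_{k=0}^\infty\frac{\varphi(R^k)}{\Phi(R^{k+n_0})}<\infty.$$ Let $\alpha\in(0,1]$ and suppose that $\Phi$ also satisfies $\int_2^\infty\frac{\log y}{\Phi(y^\alpha)}\,dy<\infty$. Let $h:(0,\infty)\to(0,\infty)$ be a non-decreasing continuous function with $\int_1^\infty\frac{du}{h(u)}<\infty$, and such that $$\sigma(t)=t^\alpha\,\Phi^{-1}\big(h(\log^*\tfrac1t)\big)$$ is increasing with $\sigma(0^+)=0$. Then there exist $c>0$ (depending on $\Phi,\alpha$) and $C>0$ (depending on $\Phi,\alpha,h$) such that every separable process $X=(X_t)_{t\in[0,1]}$ with values in a separable Banach space satisfying $$\mathbf E\,\Phi\left(\frac{|X_s-X_t|}{|s-t|^\alpha}\right)\le1\quad\text{for all }s,t\in[0,1]$$ satisfies, for all $M>0$, $$\mathbf P\big([X]_{\psi\text{-var}}>M\big)\le\frac{C}{\Phi(cM)}$$ with $\psi=\sigma^{-1}$.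
   Context: $\log^*(x)=\max(\log x,1)$; $|\cdot|$ denotes the Banach space norm. The $\psi$-variation constant on $[0,1]$ is $$[X]_{\psi\text{-var}}=\inf\Big\{M>0\ \Big|\ \sup_{t_0<\dots<t_r,\ t_i\in[0,1]}\sum_i\psi\Big(\frac{|X_{t_{i+1}}-X_{t_i}|}{M}\Big)\le1\Big\}.$$
   Formalization: The constant c depends on Φ, α and a positive lower bound for h(1), since no c depending on Φ, α alone works for all h (e.g. exponential Φ, h=ε(u+10)²); c, C are uniform over processes on one sample-space type in one ambient Banach space, which can be chosen universal. *)

theory Defs
  imports "HOL-Probability.Probability"
begin

definition convex_self_homeo :: "(real \<Rightarrow> real) \<Rightarrow> bool" where
  "convex_self_homeo f \<longleftrightarrow> convex_on {0..} f \<and> (\<exists>g. homeomorphism {0..} {0..} f g)"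

definition log_star :: "real \<Rightarrow> real" where
  "log_star x = max (ln x) 1"

(* Used for t \<ge> 0.  Since 0 powr \<alpha> = 0, the value at t = 0 is 0, which is the
   continuous extension of the function on {0<..} when its limit at 0 is 0. *)
definition sigma_fn :: "(real \<Rightarrow> real) \<Rightarrow> real \<Rightarrow> (real \<Rightarrow> real) \<Rightarrow> real \<Rightarrow> real" where
  "sigma_fn \<Phi> \<alpha> h t = t powr \<alpha> * the_inv_into {0..} \<Phi> (h (log_star (1 / t)))"

(* The inverse on {0..}.  If h is positive and non-decreasing, sigma_fn tends to infinity at
   infinity, so under the hypotheses of the theorem it is a bijection of {0..}. *)
definition psi_fn :: "(real \<Rightarrow> real) \<Rightarrow> real \<Rightarrow> (real \<Rightarrow> real) \<Rightarrow> real \<Rightarrow> real" where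
  "psi_fn \<Phi> \<alpha> h = the_inv_into {0..} (sigma_fn \<Phi> \<alpha> h)"

definition partitions :: "(nat \<times> (nat \<Rightarrow> real)) set" where
  "partitions = {(r, t). strict_mono_on {..r} t \<and> t ` {..r} \<subseteq> {0..1}}"

(* Extended-real valued: the infimum of the empty set is \<infinity>. *)
definition psi_var :: "(real \<Rightarrow> real) \<Rightarrow> (real \<Rightarrow> 'b::real_normed_vector) \<Rightarrow> ereal" where
  "psi_var \<psi> x = Inf {ereal M | M. M > 0 \<and>
     (SUP (r, t)\<in>partitions. ereal (\<Sum>i<r. \<psi> (norm (x (t (Suc i)) - x (t i)) / M))) \<le> 1}"

(* A separable Banach space is represented as a closed separable subspace of a Banach space.
   This loses nothing (take the whole space), and it lets one statement range over many
   separable Banach spaces at once: every separable Banach space is isometric to such a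
   subspace of the bounded sequences, so that a constant chosen before S does not
   depend on the Banach space. *)
definition separable_banach_subspace :: "'b::banach set \<Rightarrow> bool" where
  "separable_banach_subspace S \<longleftrightarrow>
     subspace S \<and> closed S \<and> (\<exists>D. countable D \<and> D \<subseteq> S \<and> S \<subseteq> closure D)"

definition process_on_unit :: "'w measure \<Rightarrow> 'b::banach set \<Rightarrow> (real \<Rightarrow> 'w \<Rightarrow> 'b) \<Rightarrow> bool" where
  "process_on_unit P S X \<longleftrightarrow>
     (\<forall>t\<in>{0..1}. X t \<in> borel_measurable P \<and> (\<forall>\<omega>\<in>space P. X t \<omega> \<in> S))"

(* Doob separability: off a null set, each X t is a limit of values X s with s in a fixed
   countable set, s tending to t. *)
definition separable_process :: "'w measure \<Rightarrow> (real \<Rightarrow> 'w \<Rightarrow> 'b::real_normed_vector) \<Rightarrow> bool" where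
  "separable_process P X \<longleftrightarrow>
     (\<exists>T. countable T \<and> T \<subseteq> {0..1} \<and>
       (AE \<omega> in P. \<forall>t\<in>{0..1}. \<forall>\<epsilon>>0.
          X t \<omega> \<in> closure ((\<lambda>s. X s \<omega>) ` {s\<in>T. \<bar>s - t\<bar> < \<epsilon>})))"

end

theory Submission
  imports Defs
begin

text \<open>For a path \<open>x\<close> and a scale \<open>K\<close>, let \<open>z\<^bsub>n,l\<^esub>\<close> be \<open>2\<^bsup>n\<alpha>\<^esup> / K\<close> times the norm of the increment
  over the \<open>l\<close>-th dyadic interval of length \<open>2\<^bsup>-n\<^esup>\<close>, and let \<open>W(s,t)\<close> be the sum over all dyadic intervals
  inside \<open>[s,t]\<close> of \<open>2\<^bsup>-n\<^esup> v\<^bsub>n+1\<^esub> \<Phi>(z\<^bsub>n,l\<^esub>)\<close>, restricted to \<open>z\<^bsub>n,l\<^esub> \<ge> 1\<close>. The weights \<open>v\<close> are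
  summable, dominate \<open>1 / h\<close> and decay slowly. If \<open>W(0,1) \<le> 1/2\<close>, then \<open>w(s,t) = (t - s)/2 + W(s,t)\<close> is superadditive
  and at most 1, each increment over a dyadic interval in \<open>[s,t]\<close> is bounded in terms of \<open>w(s,t)\<close>, and
  chaining over the levels gives \<open>|x\<^sub>t - x\<^sub>s| \<le> const K \<sigma>(w(s,t))\<close>, so the \<open>\<psi>\<close>-variation is at
  most \<open>const K\<close>. For \<open>K = R\<^sup>2 M\<close> supermultiplicativity yields \<open>\<Phi>(z) \<Phi>(M) \<le> \<Phi>(R\<^sup>2 z M)\<close> when
  \<open>z \<ge> 1\<close>, so \<open>E W(0,1) \<le> C / \<Phi>(M)\<close>, and Markov's inequality gives the tail.\<close>

section \<open>Supermultiplicative Orlicz functions\<close>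

text \<open>Chaining is measured at the scale of \<open>w = w(s,t)\<close>, not of
  \<open>t - s\<close>. Take \<open>2^-p\<close> comparable to \<open>w\<close>. The term
  \<open>(t - s)/2\<close> forces \<open>p \<le> n + 1\<close> for every dyadic interval of length
  \<open>2^-n\<close> inside \<open>[s,t]\<close>. The contribution of that interval to
  \<open>W\<close> is at most \<open>w \<le> 2^-p\<close>, so with \<open>k = n + 1 - p\<close> its
  \<open>\<Phi> z\<close> is at most \<open>(2 / \<theta>)^k\<close> times \<open>h\<close> at
  \<open>log_star (2^p)\<close>, where \<open>\<theta>\<close> is the decay ratio of the weights.
  The value of \<open>h\<close> produces \<open>\<sigma> w\<close>. The power is harmless only if
  \<open>\<Phi>inv\<close> grows along powers of \<open>2 / \<theta>\<close> more slowly than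
  \<open>2^(\<alpha> k)\<close>. The integral condition supplies this: it would diverge if
  \<open>\<Phi> x\<close> never exceeded \<open>(R^2 x)^(1/\<alpha>)\<close>, and
  supermultiplicativity spreads one excess to a power growth of order above
  \<open>1/\<alpha>\<close>. A second obstacle: the estimate lives on dyadic points, while the
  variation is an uncountable supremum over all partitions. Almost sure continuity, obtained from
  uniform continuity on the dyadics and separability, closes this gap and makes the event measurable
  up to a null set.\<close>

locale orlicz_fn =
  fixes \<Phi> :: "real \<Rightarrow> real"
  assumes homeo: "convex_self_homeo \<Phi>" and one: "\<Phi> 1 = 1"
begin

abbreviation \<Phi>inv :: "real \<Rightarrow> real" where "\<Phi>inv \<equiv> the_inv_into {0..} \<Phi>"

lemma cont: "continuous_on {0..} \<Phi>" and image: "\<Phi> ` {0..} = {0..}" and inj: "inj_on \<Phi> {0..}"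
  and convex: "convex_on {0..} \<Phi>"
proof -
  obtain g where g: "homeomorphism {0..} {0..} \<Phi> g" and "convex_on {0..} \<Phi>"
    using homeo unfolding convex_self_homeo_def by blast
  then show "continuous_on {0..} \<Phi>" "\<Phi> ` {0..} = {0..}" "convex_on {0..} \<Phi>"
    by (auto simp: homeomorphism_def)
  show "inj_on \<Phi> {0..}"
    using homeomorphism_apply1[OF g] by (auto intro!: inj_on_inverseI[of _ g])
qed

lemma nonneg: "x \<ge> 0 \<Longrightarrow> \<Phi> x \<ge> 0"
  using image by auto

text \<open>A zero \<open>x0 > 0\<close> contradicts injectivity: by the intermediate value theorem
  a small level \<open>b\<close> is attained on both sides of it.\<close>

lemma zero: "\<Phi> 0 = 0"
proof (rule ccontr)
  assume nz: "\<Phi> 0 \<noteq> 0"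
  obtain x0 where x0: "x0 \<ge> 0" "\<Phi> x0 = 0" using image by (metis atLeast_iff imageE order_refl)
  with nz have "x0 > 0" by (cases "x0 = 0") auto
  have pos: "\<Phi> x > 0" if "x \<ge> 0" "x \<noteq> x0" for x
    using nonneg[of x] inj_onD[OF inj, of x x0] x0 that by force
  define b where "b = min (\<Phi> 0) (\<Phi> (x0 + 1))"
  have b: "b > 0" "b \<le> \<Phi> 0" "b \<le> \<Phi> (x0 + 1)"
    unfolding b_def using pos[of 0] pos[of "x0 + 1"] \<open>x0 > 0\<close> by auto
  obtain u where u: "0 \<le> u" "u \<le> x0" "\<Phi> u = b"
    using IVT2'[of \<Phi> x0 b 0] b x0 continuous_on_subset[OF cont, of "{0..x0}"] by force
  obtain v where v: "x0 \<le> v" "v \<le> x0 + 1" "\<Phi> v = b"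
    using IVT'[of \<Phi> x0 b "x0 + 1"] b x0 continuous_on_subset[OF cont, of "{x0..x0+1}"] by force
  have "u = v" using inj_onD[OF inj, of u v] u v \<open>x0 > 0\<close> by auto
  then show False using u v x0 b by auto
qed

lemma pos: "x > 0 \<Longrightarrow> \<Phi> x > 0"
  using nonneg[of x] inj_onD[OF inj, of x 0] zero by force

lemma scale_le: "0 \<le> t \<Longrightarrow> t \<le> 1 \<Longrightarrow> 0 \<le> x \<Longrightarrow> \<Phi> (t * x) \<le> t * \<Phi> x"
  using convex_onD[OF convex, of t 0 x] zero by auto

lemma strict_mono: "0 \<le> x \<Longrightarrow> x < y \<Longrightarrow> \<Phi> x < \<Phi> y"
proof -
  assume "0 \<le> x" "x < y"
  then have "\<Phi> x \<le> x / y * \<Phi> y" using scale_le[of "x/y" y] by (simp add: field_simps)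
  also have "\<dots> < 1 * \<Phi> y" using \<open>x < y\<close> \<open>0 \<le> x\<close> pos[of y] by (intro mult_strict_right_mono) auto
  finally show ?thesis by simp
qed

lemma mono: "0 \<le> x \<Longrightarrow> x \<le> y \<Longrightarrow> \<Phi> x \<le> \<Phi> y"
  using strict_mono[of x y] by (cases "x = y") auto

text \<open>Turns the \<open>\<Phi>\<close>-moment bound into a bound for plain expectations of
  increments, from which almost sure convergence along dyadic points follows.\<close>

lemma le_one_plus: "x \<ge> 0 \<Longrightarrow> x \<le> 1 + \<Phi> x"
proof (cases "x \<le> 1")
  case False
  then have "\<Phi> 1 \<le> 1 / x * \<Phi> x" using scale_le[of "1/x" x] by (simp add: field_simps)
  then show ?thesis using False one by (simp add: field_simps)
qed (use nonneg[of x] in auto)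

lemma \<Phi>inv_nonneg: "y \<ge> 0 \<Longrightarrow> \<Phi>inv y \<ge> 0"
  using the_inv_into_into[OF inj, of y "{0..}"] image by auto

lemma \<Phi>_\<Phi>inv: "y \<ge> 0 \<Longrightarrow> \<Phi> (\<Phi>inv y) = y"
  using f_the_inv_into_f[OF inj, of y] image by auto

lemma \<Phi>inv_\<Phi>: "x \<ge> 0 \<Longrightarrow> \<Phi>inv (\<Phi> x) = x"
  using the_inv_into_f_f[OF inj, of x] by auto

lemma \<Phi>inv_le_iff: "y \<ge> 0 \<Longrightarrow> x \<ge> 0 \<Longrightarrow> \<Phi>inv y \<le> x \<longleftrightarrow> y \<le> \<Phi> x"
  using mono[of "\<Phi>inv y" x] strict_mono[of x "\<Phi>inv y"] \<Phi>_\<Phi>inv[of y] \<Phi>inv_nonneg[of y] by linarith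

lemma le_\<Phi>inv_iff: "y \<ge> 0 \<Longrightarrow> x \<ge> 0 \<Longrightarrow> x \<le> \<Phi>inv y \<longleftrightarrow> \<Phi> x \<le> y"
  using strict_mono[of "\<Phi>inv y" x] mono[of x "\<Phi>inv y"] \<Phi>_\<Phi>inv[of y] \<Phi>inv_nonneg[of y] by linarith

lemma \<Phi>inv_mono: "0 \<le> x \<Longrightarrow> x \<le> y \<Longrightarrow> \<Phi>inv x \<le> \<Phi>inv y"
  using \<Phi>inv_le_iff[of x "\<Phi>inv y"] \<Phi>inv_nonneg[of y] \<Phi>_\<Phi>inv[of y] by auto

lemma \<Phi>inv_pos: "y > 0 \<Longrightarrow> \<Phi>inv y > 0"
  using \<Phi>inv_le_iff[of y 0] zero by force

lemma \<Phi>inv_ge_one: "y \<ge> 1 \<Longrightarrow> \<Phi>inv y \<ge> 1"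
  using le_\<Phi>inv_iff[of y 1] one by auto

lemma continuous_\<Phi>inv: "continuous_on {0..} \<Phi>inv"
proof -
  obtain g where g: "homeomorphism {0..} {0..} \<Phi> g"
    using homeo unfolding convex_self_homeo_def by blast
  have "\<Phi>inv y = g y" if "y \<in> {0..}" for y
  proof -
    have "g y \<ge> 0" using homeomorphism_image2[OF g] that by auto
    then show ?thesis using \<Phi>inv_\<Phi>[of "g y"] homeomorphism_apply2[OF g that] by simp
  qed
  then have "continuous_on {0..} \<Phi>inv = continuous_on {0..} g" by (intro continuous_on_cong) auto
  then show ?thesis using homeomorphism_cont2[OF g] by simp
qed

end

locale supermult_orlicz = orlicz_fn +
  fixes R :: real
  assumes R_gt: "R > 1"
    and supermult: "\<And>x y. x \<ge> 1 \<Longrightarrow> y \<ge> 1 \<Longrightarrow> \<Phi> x * \<Phi> y \<le> \<Phi> (R\<^sup>2 * x * y)"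
begin

text \<open>Supermultiplicativity read through the inverse, at the points \<open>\<Phi>inv a\<close>
  and \<open>\<Phi>inv b\<close>, both at least 1.\<close>

lemma \<Phi>inv_mult_le:
  assumes "a \<ge> 1" "b \<ge> 1"
  shows "\<Phi>inv (a * b) \<le> R\<^sup>2 * \<Phi>inv a * \<Phi>inv b"
proof -
  have "a * b \<le> \<Phi> (R\<^sup>2 * \<Phi>inv a * \<Phi>inv b)"
    using supermult[of "\<Phi>inv a" "\<Phi>inv b"] assms \<Phi>inv_ge_one \<Phi>_\<Phi>inv[of a] \<Phi>_\<Phi>inv[of b] by auto
  then show ?thesis using assms R_gt by (subst \<Phi>inv_le_iff) (auto intro!: mult_nonneg_nonneg \<Phi>inv_nonneg)
qed

text \<open>Values of \<open>h\<close> may lie below 1, outside the range of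
  \<open>\<Phi>inv_mult_le\<close>. There \<open>\<Phi>inv y \<ge> \<Phi>inv \<eta>\<close>, and the
  constant \<open>1 / \<Phi>inv \<eta>\<close> compensates. The \<open>max 1\<close> on the left
  makes the bound cover increments below the truncation threshold too.\<close>

lemma max_\<Phi>inv_mult_le:
  assumes "\<eta> > 0" "y \<ge> \<eta>" "a \<ge> 1"
  shows "max 1 (\<Phi>inv (a * y)) \<le> max (R\<^sup>2) (1 / \<Phi>inv \<eta>) * \<Phi>inv a * \<Phi>inv y" (is "?L \<le> ?B * _ * _")
proof -
  have ga: "\<Phi>inv a \<ge> 1" and gy: "\<Phi>inv y \<ge> \<Phi>inv \<eta>" and ge: "\<Phi>inv \<eta> > 0"
    using assms by (auto intro: \<Phi>inv_ge_one \<Phi>inv_mono \<Phi>inv_pos)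
  have R2: "R\<^sup>2 \<ge> 1" using R_gt by (simp add: one_le_power)
  show ?thesis
  proof (cases "y \<ge> 1")
    case True
    have "1 \<le> \<Phi>inv a * \<Phi>inv y"
      using mult_mono[OF ga \<Phi>inv_ge_one[OF True]] ga by simp
    then have "1 * 1 \<le> R\<^sup>2 * (\<Phi>inv a * \<Phi>inv y)" using R2 by (intro mult_mono) auto
    then have "?L \<le> R\<^sup>2 * (\<Phi>inv a * \<Phi>inv y)"
      using \<Phi>inv_mult_le[OF assms(3) True] by (simp add: mult.assoc)
    also have "\<dots> \<le> ?B * (\<Phi>inv a * \<Phi>inv y)"
      using ga gy ge by (intro mult_right_mono) auto
    finally show ?thesis by (simp add: mult.assoc)
  next
    case False
    have "\<Phi>inv (a * y) \<le> \<Phi>inv a"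
      using assms False by (intro \<Phi>inv_mono) (auto simp: mult_left_le)
    then have "?L \<le> \<Phi>inv a * 1" using ga by auto
    also have "\<dots> \<le> \<Phi>inv a * (\<Phi>inv y / \<Phi>inv \<eta>)"
      using ga gy ge by (intro mult_left_mono) auto
    also have "\<dots> = (1 / \<Phi>inv \<eta>) * (\<Phi>inv a * \<Phi>inv y)" by simp
    also have "\<dots> \<le> ?B * (\<Phi>inv a * \<Phi>inv y)"
      using ga gy ge by (intro mult_right_mono) auto
    finally show ?thesis by (simp add: mult.assoc)
  qed
qed

section \<open>Power growth of \<open>\<Phi>\<close> from the integrability condition\<close>

text \<open>One good point suffices: with \<open>u = R^2 x0\<close>, each application of
  supermultiplicativity multiplies the argument by \<open>u\<close> and the value by at least
  \<open>\<Phi> x0 = u powr q\<close>, and the assumption on \<open>x0\<close> says exactly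
  \<open>q > 1/\<alpha>\<close>.\<close>

lemma power_growth:
  assumes "0 < \<alpha>" and x0: "x0 \<ge> 1" "(R\<^sup>2 * x0) powr (1 / \<alpha>) < \<Phi> x0"
  obtains q c where "q * \<alpha> > 1" "c > 0" "\<And>x. x \<ge> 1 \<Longrightarrow> c * x powr q \<le> \<Phi> x"
proof -
  define u where "u = R\<^sup>2 * x0"
  have "R\<^sup>2 > 1" using R_gt by (simp add: one_less_power)
  then have u: "u > 1" "x0 \<le> u" unfolding u_def using x0 mult_mono[of 1 "R\<^sup>2" x0 x0] by (auto simp: less_1_mult')
  have "\<Phi> x0 > 0" using x0 pos by auto
  define q where "q = log u (\<Phi> x0)"
  have uq: "u powr q = \<Phi> x0" unfolding q_def using u \<open>\<Phi> x0 > 0\<close> by simp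
  have "u powr (1 / \<alpha>) < u powr q" using x0 uq u_def by simp
  then have q: "1 / \<alpha> < q" using u powr_less_cancel_iff[of u] by blast
  have iter: "\<Phi> (u ^ n * x0) \<ge> \<Phi> x0 ^ Suc n" for n
  proof (induction n)
    case (Suc n)
    have "\<Phi> x0 ^ Suc (Suc n) \<le> \<Phi> (u ^ n * x0) * \<Phi> x0"
      using Suc \<open>\<Phi> x0 > 0\<close> by (simp add: mult.commute mult_left_mono)
    also have "\<dots> \<le> \<Phi> (R\<^sup>2 * (u ^ n * x0) * x0)"
      using x0 u by (intro supermult) (auto intro: mult_ge1_I one_le_power)
    also have "R\<^sup>2 * (u ^ n * x0) * x0 = u ^ Suc n * x0" by (simp add: u_def)
    finally show ?case .
  qed simp
  have low: "u powr (- q) * x powr q \<le> \<Phi> x" if x: "x \<ge> 1" for x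
  proof -
    \<comment> \<open>The least such \<open>n\<close>. For \<open>n = Suc m\<close>, minimality
      gives \<open>u ^ Suc m \<le> x\<close>, and \<open>x0 \<le> u\<close> then makes
      \<open>iter\<close> at \<open>m\<close> yield all \<open>n\<close> factors.\<close>
    obtain n where n: "x < u ^ Suc n" "\<And>m. m < n \<Longrightarrow> \<not> x < u ^ Suc m"
    proof -
      obtain n0 where "x < u ^ n0" using real_arch_pow[OF u(1)] by blast
      then have "x < u ^ Suc n0" using less_le_trans[OF _ power_increasing[of n0 "Suc n0" u]] u by simp
      then show thesis using that[of "LEAST n. x < u ^ Suc n"]
        by (metis (no_types, lifting) LeastI not_less_Least)
    qed
    have "\<Phi> x0 ^ n \<le> \<Phi> x"
    proof (cases n)
      case 0
      then show ?thesis using mono[of 1 x] one x by auto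
    next
      case (Suc m)
      then have "u ^ m * u \<le> x" using n(2)[of m] by (auto simp: mult.commute)
      moreover have "u ^ m * x0 \<le> u ^ m * u" using u by (intro mult_left_mono) auto
      ultimately have "u ^ m * x0 \<le> x" by linarith
      then have "\<Phi> (u ^ m * x0) \<le> \<Phi> x" using u x0 by (intro mono) auto
      then show ?thesis using iter[of m] Suc by simp
    qed
    moreover have "x powr q \<le> (u ^ Suc n) powr q"
      using n x q \<open>0 < \<alpha>\<close> by (intro powr_mono2) (auto intro: order_trans[OF _ less_imp_le[OF q]])
    moreover have "(u ^ Suc n) powr q = u powr q * \<Phi> x0 ^ n"
      using u by (simp add: uq[symmetric] powr_mult powr_power powr_powr mult.commute flip: powr_realpow)
    moreover have "u powr q * \<Phi> x0 ^ n \<le> u powr q * \<Phi> x"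
      using \<open>\<Phi> x0 ^ n \<le> \<Phi> x\<close> by (intro mult_left_mono) auto
    ultimately have "x powr q \<le> u powr q * \<Phi> x" by linarith
    then show ?thesis using u by (simp add: powr_minus field_simps)
  qed
  show thesis
    by (rule that[of q "u powr (-q)"]) (use q \<open>0 < \<alpha>\<close> u low in \<open>auto simp: field_simps\<close>)
qed

text \<open>Otherwise \<open>\<Phi> (y powr \<alpha>) \<le> A * y\<close>, so the integrand
  dominates a multiple of \<open>1 / y\<close> and the integral diverges logarithmically.\<close>

lemma exists_large_value:
  assumes \<alpha>: "0 < \<alpha>"
    and int: "(\<integral>\<^sup>+y\<in>{2..}. ennreal (ln y / \<Phi> (y powr \<alpha>)) \<partial>lborel) < \<infinity>"
  obtains x0 where "x0 \<ge> 1" "(R\<^sup>2 * x0) powr (1 / \<alpha>) < \<Phi> x0"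
proof (rule ccontr)
  assume no: "\<not> thesis"
  note witness = that
  have le: "\<Phi> x \<le> (R\<^sup>2 * x) powr (1 / \<alpha>)" if "x \<ge> 1" for x
    using witness[of x] that no by force
  define A where "A = (R\<^sup>2) powr (1 / \<alpha>)"
  have A: "A > 0" using R_gt by (simp add: A_def)
  have lower: "ln 2 / A * (1 / y) \<le> ln y / \<Phi> (y powr \<alpha>)" if y: "y \<ge> 2" for y
  proof -
    have "\<Phi> (y powr \<alpha>) \<le> A * y"
      using le[of "y powr \<alpha>"] y \<alpha> by (simp add: ge_one_powr_ge_zero powr_mult powr_powr A_def)
    moreover have "\<Phi> (y powr \<alpha>) > 0" using y by (intro pos) auto
    ultimately have "ln 2 / (A * y) \<le> ln y / \<Phi> (y powr \<alpha>)"
      using y A by (intro frac_le) auto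
    then show ?thesis by simp
  qed
  define I where "I = (\<integral>\<^sup>+y\<in>{2..}. ennreal (ln y / \<Phi> (y powr \<alpha>)) \<partial>lborel)"
  have big: "ennreal (ln 2 / A * (ln b - ln 2)) \<le> I" if b: "b \<ge> 2" for b
  proof -
    have "(\<integral>\<^sup>+y. ennreal (ln 2 / A * (1 / y)) * indicator {2..b} y \<partial>lborel)
        = ennreal (ln 2 / A * ln b - ln 2 / A * ln 2)"
      using b A by (intro nn_integral_FTC_Icc) (auto intro!: derivative_eq_intros)
    moreover have "(\<integral>\<^sup>+y. ennreal (ln 2 / A * (1 / y)) * indicator {2..b} y \<partial>lborel) \<le> I"
      unfolding I_def using lower
      by (intro nn_integral_mono) (auto simp: indicator_def intro!: ennreal_leI)
    ultimately show ?thesis by (simp add: right_diff_distrib)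
  qed
  have "I < \<infinity>" using int I_def by simp
  then obtain r where r: "I = ennreal r" "r \<ge> 0" by (cases I) auto
  \<comment> \<open>Solves \<open>ln 2 / A * (ln b - ln 2) = r + 1\<close>, one more than the
    supposed value of the integral.\<close>
  define b where "b = exp (ln 2 + (r + 1) * (A / ln 2))"
  have "b \<ge> exp (ln 2)" unfolding b_def using r A by (subst exp_le_cancel_iff) auto
  then have "b \<ge> 2" by simp
  have "ln 2 / A * (ln b - ln 2) = r + 1" unfolding b_def using A by (simp add: field_simps)
  then show False using big[OF \<open>b \<ge> 2\<close>] r by (simp add: ennreal_le_iff)
qed

text \<open>Supermultiplicativity upgrades the integrability condition to a power growth of order
  strictly larger than \<open>1 / \<alpha>\<close>, which makes the chaining sums below geometric.\<close>

lemma \<Phi>inv_geometric: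
  assumes \<alpha>: "0 < \<alpha>"
    and int: "(\<integral>\<^sup>+y\<in>{2..}. ennreal (ln y / \<Phi> (y powr \<alpha>)) \<partial>lborel) < \<infinity>"
  obtains \<theta> \<rho> A where "0 < \<theta>" "\<theta> < 1" "0 < \<rho>" "\<rho> < 1" "0 < A"
    "\<And>k. \<Phi>inv ((2 / \<theta>) ^ k) \<le> A * (2 powr \<alpha> * \<rho>) ^ k"
proof -
  obtain x0 where "x0 \<ge> 1" "(R\<^sup>2 * x0) powr (1 / \<alpha>) < \<Phi> x0"
    using exists_large_value[OF \<alpha> int] by blast
  then obtain q c where q: "q * \<alpha> > 1" and c: "c > 0" and gr: "\<And>x. x \<ge> 1 \<Longrightarrow> c * x powr q \<le> \<Phi> x"
    using power_growth[OF \<alpha>] by blast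
  have q0: "q > 0" using q \<alpha> by (metis less_trans zero_less_mult_pos2 zero_less_one)
  \<comment> \<open>The surplus \<open>q * \<alpha> - 1\<close> is split: half of it is spent on
    \<open>\<theta>\<close>, giving
    \<open>2 / \<theta> = 2 powr (1 + (q * \<alpha> - 1) / 2)\<close>. Since
    \<open>\<Phi>inv y\<close> is at most a multiple of \<open>y powr (1 / q)\<close>, the other
    half leaves the ratio \<open>\<rho>\<close> below 1.\<close>
  define \<theta> where "\<theta> = 2 powr (- ((q * \<alpha> - 1) / 2))"
  define \<rho> where "\<rho> = (2 / \<theta>) powr (1 / q) / 2 powr \<alpha>"
  have \<theta>: "0 < \<theta>" "\<theta> < 1" unfolding \<theta>_def using q powr_less_one[of 2 "- ((q * \<alpha> - 1) / 2)"] by auto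
  have "2 powr (1 - - ((q * \<alpha> - 1) / 2)) = 2 powr 1 / \<theta>"
    unfolding \<theta>_def by (rule powr_diff)
  then have "2 / \<theta> = 2 powr (1 + (q * \<alpha> - 1) / 2)" by simp
  then have "(2 / \<theta>) powr (1 / q) = 2 powr ((1 + (q * \<alpha> - 1) / 2) / q)" by (simp add: powr_powr)
  moreover have "(1 + (q * \<alpha> - 1) / 2) / q < \<alpha>"
  proof -
    have "1 + (z - 1) / 2 < z" if "z > 1" for z :: real using that by (simp add: field_simps)
    from this[OF q] have "1 + (q * \<alpha> - 1) / 2 < q * \<alpha>" .
    then show ?thesis using q0 by (simp add: pos_divide_less_eq mult.commute[of \<alpha> q])
  qed
  then have "2 powr ((1 + (q * \<alpha> - 1) / 2) / q) < 2 powr \<alpha>" by (intro powr_less_mono) auto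
  ultimately have \<rho>: "\<rho> < 1" unfolding \<rho>_def by simp
  have bd: "\<Phi>inv ((2 / \<theta>) ^ k) \<le> (1 / c) powr (1 / q) * (2 powr \<alpha> * \<rho>) ^ k" for k
  proof -
    define a where "a = (2 / \<theta>) ^ k"
    have "2 / \<theta> > 1" using \<theta> by auto
    then have a: "a \<ge> 1" unfolding a_def by (intro one_le_power) auto
    then have "c * \<Phi>inv a powr q \<le> a" using gr[OF \<Phi>inv_ge_one[OF a]] \<Phi>_\<Phi>inv[of a] by simp
    then have "\<Phi>inv a powr q \<le> a / c" using c by (simp add: field_simps)
    then have "(\<Phi>inv a powr q) powr (1 / q) \<le> (a / c) powr (1 / q)" using q0 by (intro powr_mono2) auto
    then have "\<Phi>inv a \<le> (a / c) powr (1 / q)" using q0 \<Phi>inv_nonneg[of a] a by (simp add: powr_powr)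
    also have "(a / c) powr (1 / q) = (1 / c) powr (1 / q) * a powr (1 / q)"
      using a c powr_mult[of "1/c" a "1/q"] by simp
    also have "a powr (1 / q) = (2 powr \<alpha> * \<rho>) ^ k"
      unfolding a_def \<rho>_def using \<theta> by (simp add: powr_power mult.commute powr_powr flip: powr_realpow)
    finally show ?thesis unfolding a_def .
  qed
  show thesis
    by (rule that[of \<theta> \<rho> "(1 / c) powr (1 / q)"]) (use \<theta> \<rho> c bd in \<open>auto simp: \<rho>_def\<close>)
qed

end

section \<open>Dyadic chaining\<close>

definition dy :: "nat \<Rightarrow> nat \<Rightarrow> real" where
  "dy n l = real l / 2 ^ n"

lemma dy_double [simp]: "dy (Suc n) (2 * l) = dy n l"
  by (simp add: dy_def)

lemma dy_mono: "i \<le> j \<Longrightarrow> dy n i \<le> dy n j"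
  by (simp add: dy_def divide_right_mono)

lemma dy_nonneg [simp]: "0 \<le> dy n i"
  by (simp add: dy_def)

lemma dy_le_one: "i \<le> 2 ^ n \<Longrightarrow> dy n i \<le> 1"
  by (simp add: dy_def of_nat_le_numeral_power_cancel_iff)

lemma dy_Suc: "dy n (Suc l) = dy n l + 1 / 2 ^ n"
  by (simp add: dy_def add_divide_distrib)

text \<open>An interval with dyadic end points splits into standard dyadic intervals, at most two of each
  length: passing from level \<open>N + 1\<close> to level \<open>N\<close> cuts off at most one at either end.\<close>

lemma dyadic_chaining:
  fixes x :: "real \<Rightarrow> 'b::real_normed_vector"
  assumes D0: "\<And>n. 0 \<le> D n"
    and D: "\<And>n l. n \<le> N \<Longrightarrow> dy N i \<le> dy n l \<Longrightarrow> dy n (Suc l) \<le> dy N j \<Longrightarrow>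
      norm (x (dy n (Suc l)) - x (dy n l)) \<le> D n"
    and "i \<le> j" "j \<le> 2 ^ N"
  shows "norm (x (dy N j) - x (dy N i)) \<le> 2 * (\<Sum>n\<le>N. D n)"
  using D \<open>i \<le> j\<close> \<open>j \<le> 2 ^ N\<close>
proof (induction N arbitrary: i j)
  case 0
  then have "i = j \<or> (i = 0 \<and> j = 1)" by auto
  then show ?case using "0.prems"(1)[of 0 0] D0[of 0] by auto
next
  case (Suc N)
  \<comment> \<open>Both end points are rounded inwards: \<open>i / 2\<close> up and
    \<open>j / 2\<close> down.\<close>
  define i' j' where "i' = Suc i div 2" and "j' = j div 2"
  have j': "j = 2 * j' \<or> j = Suc (2 * j')" and i': "2 * i' = i \<or> 2 * i' = Suc i"
    unfolding i'_def j'_def by linarith+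
  show ?case
  proof (cases "i' \<le> j'")
    case False
    \<comment> \<open>Inward rounding can make the end points cross only when \<open>i\<close> and
      \<open>j\<close> are the same odd number.\<close>
    then have "i = j" using i' j' Suc.prems(2) by linarith
    then show ?thesis using D0 by (simp add: sum_nonneg)
  next
    case True
    have ii: "dy (Suc N) i \<le> dy N i'" using i' dy_mono[of i "2 * i'" "Suc N"] by auto
    have jj: "dy N j' \<le> dy (Suc N) j" using j' dy_mono[of "2 * j'" j "Suc N"] by auto
    have mid: "norm (x (dy N j') - x (dy N i')) \<le> 2 * (\<Sum>n\<le>N. D n)"
    proof (rule Suc.IH)
      show "norm (x (dy n (Suc l)) - x (dy n l)) \<le> D n"
        if "n \<le> N" "dy N i' \<le> dy n l" "dy n (Suc l) \<le> dy N j'" for n l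
        using that ii jj by (intro Suc.prems(1)) auto
      show "i' \<le> j'" by fact
      show "j' \<le> 2 ^ N" using j' Suc.prems(3) by auto
    qed
    have ij: "i \<le> 2 * i'" "2 * i' \<le> 2 * j'" "2 * j' \<le> j" using i' j' True by auto
    have left: "norm (x (dy N i') - x (dy (Suc N) i)) \<le> D (Suc N)"
    proof (cases "2 * i' = i")
      case True
      then have "dy N i' = dy (Suc N) i" by (metis dy_double)
      then show ?thesis using D0 by simp
    next
      case False
      then have e: "Suc i = 2 * i'" using i' by auto
      have "dy (Suc N) (Suc i) \<le> dy (Suc N) j" using ij e by (intro dy_mono) auto
      then have "norm (x (dy (Suc N) (Suc i)) - x (dy (Suc N) i)) \<le> D (Suc N)"
        by (intro Suc.prems(1)) auto
      then show ?thesis using e by (metis dy_double)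
    qed
    have right: "norm (x (dy (Suc N) j) - x (dy N j')) \<le> D (Suc N)"
    proof (cases "j = 2 * j'")
      case True
      then show ?thesis using D0 by simp
    next
      case False
      then have e: "j = Suc (2 * j')" using j' by auto
      have "dy (Suc N) i \<le> dy (Suc N) (2 * j')" using ij by (intro dy_mono) auto
      then have "norm (x (dy (Suc N) (Suc (2 * j'))) - x (dy (Suc N) (2 * j'))) \<le> D (Suc N)"
        using e by (intro Suc.prems(1)) auto
      then show ?thesis using e by simp
    qed
    have "norm (x (dy (Suc N) j) - x (dy (Suc N) i)) \<le>
      norm (x (dy (Suc N) j) - x (dy N j')) + norm (x (dy N j') - x (dy N i')) + norm (x (dy N i') - x (dy (Suc N) i))"
      by norm
    also have "\<dots> \<le> D (Suc N) + 2 * (\<Sum>n\<le>N. D n) + D (Suc N)"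
      using left mid right by linarith
    finally show ?thesis by simp
  qed
qed

section \<open>The functions \<open>\<sigma>\<close> and \<open>\<psi>\<close>\<close>

text \<open>\<open>\<theta>\<close>, \<open>\<rho>\<close> and \<open>A\<close> are the output of
  \<open>\<Phi>inv_geometric\<close>. As parameters, together with the lower bound
  \<open>\<eta>\<close> for \<open>h 1\<close>, they keep the chaining constant independent of
  \<open>h\<close> itself.\<close>

locale gauge = supermult_orlicz +
  fixes \<alpha> :: real and h :: "real \<Rightarrow> real" and \<eta> \<theta> \<rho> A :: real
  assumes \<alpha>: "0 < \<alpha>"
    and h_pos: "\<And>u. u > 0 \<Longrightarrow> h u > 0"
    and h_mono: "mono_on {0<..} h" and h_cont: "continuous_on {0<..} h"
    and h_int: "(\<integral>\<^sup>+u\<in>{1..}. ennreal (1 / h u) \<partial>lborel) < \<infinity>"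
    and \<sigma>_mono: "strict_mono_on {0<..} (sigma_fn \<Phi> \<alpha> h)"
    and \<sigma>_lim: "(sigma_fn \<Phi> \<alpha> h \<longlongrightarrow> 0) (at_right 0)"
    and \<eta>: "\<eta> > 0" and h1: "h 1 \<ge> \<eta>"
    and \<theta>: "0 < \<theta>" "\<theta> < 1" and \<rho>: "0 < \<rho>" "\<rho> < 1" and A: "0 < A"
    and geom: "\<And>k. \<Phi>inv ((2 / \<theta>) ^ k) \<le> A * (2 powr \<alpha> * \<rho>) ^ k"
begin

abbreviation \<sigma> :: "real \<Rightarrow> real" where "\<sigma> \<equiv> sigma_fn \<Phi> \<alpha> h"
abbreviation \<psi> :: "real \<Rightarrow> real" where "\<psi> \<equiv> psi_fn \<Phi> \<alpha> h"

lemma log_star_ge_one: "log_star x \<ge> 1"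
  by (simp add: log_star_def)

lemma log_star_mono: "0 < x \<Longrightarrow> x \<le> y \<Longrightarrow> log_star x \<le> log_star y"
  unfolding log_star_def by (intro max.mono) auto

lemma h_log_star_mono: "0 < x \<Longrightarrow> x \<le> y \<Longrightarrow> h (log_star x) \<le> h (log_star y)"
  using log_star_mono[of x y] log_star_ge_one[of x] by (intro mono_onD[OF h_mono]) auto

lemma h_log_star_pos: "h (log_star x) > 0"
  using log_star_ge_one[of x] by (intro h_pos) auto

lemma h_log_star_ge: "h (log_star x) \<ge> \<eta>"
  using mono_onD[OF h_mono, of 1 "log_star x"] log_star_ge_one[of x] h1 by auto

lemma \<sigma>_zero: "\<sigma> 0 = 0"
  by (simp add: sigma_fn_def)

lemma \<sigma>_pos: "t > 0 \<Longrightarrow> \<sigma> t > 0"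
  by (simp add: sigma_fn_def \<Phi>inv_pos h_log_star_pos)

lemma \<sigma>_strict_mono: "0 \<le> s \<Longrightarrow> s < t \<Longrightarrow> \<sigma> s < \<sigma> t"
  using strict_mono_onD[OF \<sigma>_mono, of s t] \<sigma>_pos[of t] \<sigma>_zero by (cases "s = 0") auto

lemma \<sigma>_monotone: "0 \<le> s \<Longrightarrow> s \<le> t \<Longrightarrow> \<sigma> s \<le> \<sigma> t"
  using \<sigma>_strict_mono[of s t] by (cases "s = t") auto

section \<open>Continuity of \<open>\<sigma>\<close> and of its inverse\<close>

lemma continuous_\<sigma>: "continuous_on {0<..} \<sigma>"
proof -
  have "continuous_on {0<..} (\<lambda>t. h (log_star (1 / t)))"
    unfolding log_star_def
    by (rule continuous_on_compose2[OF h_cont]) (auto intro!: continuous_intros simp: less_max_iff_disj)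
  then have "continuous_on {0<..} (\<lambda>t. \<Phi>inv (h (log_star (1 / t))))"
    by (rule continuous_on_compose2[OF continuous_\<Phi>inv]) (auto intro: less_imp_le h_log_star_pos)
  then show ?thesis
    unfolding sigma_fn_def by (intro continuous_intros) auto
qed

lemma \<sigma>_surj: "y \<ge> 0 \<Longrightarrow> \<exists>t\<ge>0. \<sigma> t = y"
proof (cases "y = 0")
  case True
  then show ?thesis using \<sigma>_zero by auto
next
  case False
  assume "y \<ge> 0"
  with False have y: "y > 0" by auto
  have "\<forall>\<^sub>F t in at_right 0. \<sigma> t < y" using order_tendstoD(2)[OF \<sigma>_lim y] .
  then obtain b where "b > 0" and b: "\<And>t. 0 < t \<Longrightarrow> t < b \<Longrightarrow> \<sigma> t < y"
    unfolding eventually_at_right_field by auto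
  define G where "G = \<Phi>inv (h 1)"
  have G: "G > 0" unfolding G_def by (intro \<Phi>inv_pos h_pos) auto
  \<comment> \<open>For \<open>t \<ge> 1\<close> the logarithm is cut off at 1, so
    \<open>\<sigma>\<close> is the power function \<open>t powr \<alpha> * G\<close> there, and this
    \<open>t2\<close> reaches the level \<open>y\<close>.\<close>
  define t2 where "t2 = max 1 ((y / G) powr (1 / \<alpha>))"
  define t1 where "t1 = min (b / 2) 1"
  have t: "0 < t1" "t1 \<le> t2" "\<sigma> t1 < y" unfolding t1_def t2_def using \<open>b > 0\<close> b[of "min (b/2) 1"] by auto
  have "t2 \<ge> 1" by (simp add: t2_def)
  then have "ln (1 / t2) \<le> 0" by (subst ln_le_zero_iff) auto
  then have "log_star (1 / t2) = 1" by (simp add: log_star_def)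
  then have "\<sigma> t2 = t2 powr \<alpha> * G" by (simp add: sigma_fn_def G_def)
  moreover have "t2 powr \<alpha> \<ge> ((y / G) powr (1 / \<alpha>)) powr \<alpha>"
    using \<alpha> unfolding t2_def by (intro powr_mono2) auto
  then have "t2 powr \<alpha> \<ge> y / G" using \<alpha> y G by (simp add: powr_powr)
  ultimately have "\<sigma> t2 \<ge> y" using G by (simp add: field_simps)
  then obtain t' where "t1 \<le> t'" "t' \<le> t2" "\<sigma> t' = y"
    using IVT'[of \<sigma> t1 y t2] t continuous_on_subset[OF continuous_\<sigma>, of "{t1..t2}"] by force
  then show ?thesis using t by (intro exI[of _ t']) auto
qed

lemma inj_\<sigma>: "inj_on \<sigma> {0..}"
  by (intro linorder_inj_onI') (auto dest: \<sigma>_strict_mono)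

lemma image_\<sigma>: "\<sigma> ` {0..} = {0..}"
proof -
  have "\<sigma> t \<ge> 0" if "t \<ge> 0" for t using \<sigma>_monotone[of 0 t] \<sigma>_zero that by auto
  then show ?thesis using \<sigma>_surj by (force simp: image_iff)
qed

lemma \<psi>_nonneg: "x \<ge> 0 \<Longrightarrow> \<psi> x \<ge> 0"
  unfolding psi_fn_def using the_inv_into_into[OF inj_\<sigma>, of x "{0..}"] image_\<sigma> by auto

lemma \<sigma>_\<psi>: "x \<ge> 0 \<Longrightarrow> \<sigma> (\<psi> x) = x"
  unfolding psi_fn_def using f_the_inv_into_f[OF inj_\<sigma>, of x] image_\<sigma> by auto

lemma \<psi>_le: "0 \<le> x \<Longrightarrow> 0 \<le> w \<Longrightarrow> x \<le> \<sigma> w \<Longrightarrow> \<psi> x \<le> w"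
  using \<sigma>_strict_mono[of w "\<psi> x"] \<sigma>_\<psi>[of x] by force

lemma \<psi>_mono: "0 \<le> x \<Longrightarrow> x \<le> y \<Longrightarrow> \<psi> x \<le> \<psi> y"
  by (rule \<psi>_le) (auto simp: \<psi>_nonneg \<sigma>_\<psi>)

text \<open>Extending \<open>\<psi>\<close> by the identity to the negative reals gives a monotone
  surjection of the whole line; a monotone map with open image is continuous.\<close>

lemma continuous_\<psi>: "continuous_on {0..} \<psi>"
proof -
  define f where "f x = (if x < 0 then x else \<psi> x)" for x
  have "\<psi> (\<sigma> t) = t" if "t \<ge> 0" for t
    unfolding psi_fn_def using the_inv_into_f_f[OF inj_\<sigma>, of t] that by auto
  moreover have "\<sigma> t \<ge> 0" if "t \<ge> 0" for t using image_\<sigma> that by auto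
  ultimately have "f (if y < 0 then y else \<sigma> y) = y" for y
    by (simp add: f_def not_less)
  then have "range f = UNIV" by (rule surjI)
  moreover have "f x \<le> f y" if "x \<le> y" for x y
    using that \<psi>_mono[of x y] \<psi>_nonneg[of y] by (auto simp: f_def)
  ultimately have "continuous_on UNIV f" by (intro continuous_onI_mono) auto
  then have "continuous_on {0..} f" by (rule continuous_on_subset) auto
  then show ?thesis by (rule continuous_on_eq) (auto simp: f_def)
qed

text \<open>The sequence \<open>1 / h (log* 2\<^sup>m)\<close> may drop arbitrarily fast; \<open>weight\<close> is a summable
  majorant of it that decreases at most geometrically.\<close>

definition weight :: "nat \<Rightarrow> real" where
  "weight n = (\<Sum>m\<le>n. 1 / h (log_star (2 ^ m)) * \<theta> ^ (n - m))"

text \<open>Integral test on a logarithmic scale. The intervals \<open>I m\<close> are disjoint, of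
  length \<open>ln 2\<close>, and \<open>1 / h u \<ge> g (m + 3)\<close> on \<open>I m\<close>. The
  shift by 3 keeps them inside \<open>[1, \<infinity>)\<close>, because
  \<open>2 * ln 2 \<ge> 1\<close>.\<close>

lemma summable_inverse_h: "summable (\<lambda>m. 1 / h (log_star (2 ^ m)))"
proof -
  define g where "g m = 1 / h (log_star (2 ^ m))" for m :: nat
  define I where "I m = {real (m + 2) * ln 2 <.. real (m + 3) * ln 2}" for m :: nat
  have g0: "g m \<ge> 0" for m unfolding g_def using h_log_star_pos[of "2 ^ m"] by simp
  have e: "real i * ln 2 \<le> real j * ln 2" if "i \<le> j" for i j :: nat
    using that by (intro mult_right_mono) auto
  have disj: "disjoint_family I"
    unfolding disjoint_family_on_def
  proof (intro ballI impI)
    have "I m \<inter> I n = {}" if "m < n" for m n using e[of "m + 3" "n + 2"] that by (auto simp: I_def)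
    then show "I m \<inter> I n = {}" if "m \<noteq> n" for m n using that by (metis Int_commute nat_neq_iff)
  qed
  have len: "emeasure lborel (I m) = ennreal (ln 2)" for m
    using e[of "m+2" "m+3"] unfolding I_def by (simp add: algebra_simps)
  have meas: "I m \<in> sets lborel" for m by (simp add: I_def)
  have "(\<integral>\<^sup>+u. ennreal (g (m + 3)) * indicator (I m) u \<partial>lborel) = ennreal (ln 2 * g (m + 3))" for m
    unfolding nn_integral_cmult_indicator[OF meas] len by (simp add: ennreal_mult g0 mult.commute)
  then have "(\<Sum>m. ennreal (ln 2 * g (m + 3))) = (\<Sum>m. \<integral>\<^sup>+u. ennreal (g (m + 3)) * indicator (I m) u \<partial>lborel)"
    by simp
  also have "\<dots> = (\<integral>\<^sup>+u. (\<Sum>m. ennreal (g (m + 3)) * indicator (I m) u) \<partial>lborel)"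
    by (rule nn_integral_suminf[symmetric]) (auto simp: I_def)
  also have "\<dots> \<le> (\<integral>\<^sup>+u\<in>{1..}. ennreal (1 / h u) \<partial>lborel)"
  proof (rule nn_integral_mono)
    fix u :: real
    show "(\<Sum>m. ennreal (g (m + 3)) * indicator (I m) u) \<le> ennreal (1 / h u) * indicator {1..} u"
    proof (cases "\<exists>m. u \<in> I m")
      case True
      then obtain m where m: "u \<in> I m" by blast
      have "(\<Sum>m. ennreal (g (m + 3)) * indicator (I m) u) = ennreal (g (m + 3))"
        by (rule suminf_cmult_indicator[OF disj m])
      moreover have ln2: "ln 2 \<ge> (1/2::real)" using ln2_ge_two_thirds by linarith
      have "real (m + 2) * ln 2 \<ge> 2 * (1/2)" using ln2 by (intro mult_mono) auto
      then have "u \<ge> 1" using m by (auto simp: I_def)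
      moreover have "u \<le> log_star (2 ^ (m + 3))"
        using m by (auto simp: I_def log_star_def ln_realpow)
      then have "h u \<le> h (log_star (2 ^ (m + 3)))" using \<open>u \<ge> 1\<close> by (intro mono_onD[OF h_mono]) auto
      then have "g (m + 3) \<le> 1 / h u" unfolding g_def using h_pos[of u] \<open>u \<ge> 1\<close> by (intro divide_left_mono) auto
      ultimately show ?thesis by (simp add: ennreal_leI)
    next
      case False
      then show ?thesis by simp
    qed
  qed
  also have "\<dots> < \<infinity>" by (rule h_int)
  finally have "summable (\<lambda>m. ln 2 * g (m + 3))"
    by (intro summable_suminf_not_top) (auto simp: g0)
  then have "summable (\<lambda>m. g (m + 3))" by (subst (asm) summable_cmult_iff) auto
  then show ?thesis unfolding g_def[symmetric] by (subst (asm) summable_iff_shift)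
qed

text \<open>\<open>weight\<close> is the Cauchy product of two summable sequences, the values of
  \<open>1 / h\<close> and the powers of \<open>\<theta>\<close>.\<close>

lemma summable_weight: "summable weight"
proof -
  have "summable (\<lambda>m. norm (1 / h (log_star (2 ^ m))))"
    using summable_inverse_h h_log_star_pos by (simp add: abs_of_pos)
  moreover have "summable (\<lambda>m. norm (\<theta> ^ m))" using \<theta> by (simp add: summable_geometric)
  ultimately show ?thesis unfolding weight_def by (rule summable_Cauchy_product)
qed

text \<open>Only the summand \<open>m = p\<close> is kept. This compares the weight \<open>k\<close>
  levels below scale \<open>p\<close> with \<open>h\<close> at scale \<open>p\<close>, at the cost
  of \<open>\<theta> ^ k\<close>.\<close>

lemma weight_lower: "\<theta> ^ k / h (log_star (2 ^ p)) \<le> weight (p + k)"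
proof -
  have "1 / h (log_star (2 ^ p)) * \<theta> ^ (p + k - p) \<le> weight (p + k)"
    unfolding weight_def using \<theta> h_log_star_pos
    by (intro member_le_sum) (auto intro!: mult_nonneg_nonneg simp: less_imp_le)
  then show ?thesis by simp
qed

lemma weight_pos: "weight n > 0"
  using weight_lower[of n 0] h_log_star_pos[of "2 ^ 0"] \<theta> weight_lower[of 0 n]
  by (smt (verit) add_0 divide_pos_pos zero_less_power)

end

section \<open>Superadditive control of a path\<close>

context gauge
begin

definition incr :: "real \<Rightarrow> (real \<Rightarrow> 'b::real_normed_vector) \<Rightarrow> nat \<Rightarrow> nat \<Rightarrow> real" where
  "incr K x n l = (2 powr \<alpha>) ^ n * norm (x (dy n (Suc l)) - x (dy n l)) / K"

text \<open>The cut at 1 reflects that supermultiplicativity is available only for arguments at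
  least 1; a smaller \<open>incr\<close> is bounded by 1 and needs no budget.\<close>

definition excess :: "real \<Rightarrow> (real \<Rightarrow> 'b::real_normed_vector) \<Rightarrow> nat \<Rightarrow> nat \<Rightarrow> real" where
  "excess K x n l = (if incr K x n l \<ge> 1 then \<Phi> (incr K x n l) else 0)"

text \<open>The weight has index \<open>Suc n\<close> because an interval of length
  \<open>2^-n\<close> guarantees only a control of \<open>2^-(n+1)\<close>, so the scale
  \<open>p\<close> of the control may be as large as \<open>n + 1\<close>.\<close>

definition level_excess :: "real \<Rightarrow> (real \<Rightarrow> 'b::real_normed_vector) \<Rightarrow> real \<Rightarrow> real \<Rightarrow> nat \<Rightarrow> real" where
  "level_excess K x s t n = weight (Suc n) / 2 ^ n *
     (\<Sum>l<2^n. if s \<le> dy n l \<and> dy n (Suc l) \<le> t then excess K x n l else 0)"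

text \<open>Summability is demanded separately since \<open>suminf\<close> of a divergent real
  series has no meaningful value.\<close>

definition tame :: "real \<Rightarrow> (real \<Rightarrow> 'b::real_normed_vector) \<Rightarrow> bool" where
  "tame K x \<longleftrightarrow> summable (level_excess K x 0 1) \<and> suminf (level_excess K x 0 1) \<le> 1 / 2"

definition control :: "real \<Rightarrow> (real \<Rightarrow> 'b::real_normed_vector) \<Rightarrow> real \<Rightarrow> real \<Rightarrow> real" where
  "control K x s t = (t - s) / 2 + suminf (level_excess K x s t)"

text \<open>Origin of the factors: 2 from \<open>dyadic_chaining\<close>, the maximum from
  \<open>max_\<Phi>inv_mult_le\<close>, \<open>A\<close> from \<open>geom\<close>,
  \<open>1 / (1 - \<rho>)\<close> from the geometric series. One factor
  \<open>2 powr \<alpha>\<close> comes from the shift in \<open>Suc n = p + k\<close>, the other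
  from passing from \<open>2^-(p+1)\<close> to the control.\<close>

definition chain_const :: real where
  "chain_const = 2 * max (R\<^sup>2) (1 / \<Phi>inv \<eta>) * A * (2 powr \<alpha>)\<^sup>2 / (1 - \<rho>)"

lemma chain_const_pos: "chain_const > 0"
  unfolding chain_const_def using \<rho> A R_gt
  by (intro divide_pos_pos mult_pos_pos) (auto simp: less_max_iff_disj)

lemma excess_nonneg: "excess K x n l \<ge> 0"
  unfolding excess_def using nonneg[of "incr K x n l"] by auto

lemma level_excess_nonneg: "level_excess K x s t n \<ge> 0"
  unfolding level_excess_def using weight_pos[of "Suc n"]
  by (intro mult_nonneg_nonneg sum_nonneg) (auto simp: excess_nonneg)

lemma level_excess_mono:
  "s' \<le> s \<Longrightarrow> t \<le> t' \<Longrightarrow> level_excess K x s t n \<le> level_excess K x s' t' n"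
  unfolding level_excess_def using weight_pos[of "Suc n"]
  by (intro mult_left_mono sum_mono) (auto simp: excess_nonneg)

text \<open>A dyadic interval has positive length, so it cannot lie in both \<open>[a,b]\<close> and
  \<open>[b,c]\<close>; no term is counted twice.\<close>

lemma level_excess_superadditive:
  "a \<le> b \<Longrightarrow> b \<le> c \<Longrightarrow> level_excess K x a b n + level_excess K x b c n \<le> level_excess K x a c n"
proof -
  assume "a \<le> b" "b \<le> c"
  have "dy n l < dy n (Suc l)" for l by (simp add: dy_Suc)
  then have "\<not> (dy n (Suc l) \<le> b \<and> b \<le> dy n l)" for l by (meson leD order_trans)
  then show ?thesis
    unfolding level_excess_def distrib_left[symmetric] sum.distrib[symmetric]
    using \<open>a \<le> b\<close> \<open>b \<le> c\<close> weight_pos[of "Suc n"]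
    by (intro mult_left_mono sum_mono) (auto simp: excess_nonneg intro: order_trans)
qed

lemma excess_le_level_excess:
  assumes "l < 2 ^ n" "s \<le> dy n l" "dy n (Suc l) \<le> t"
  shows "weight (Suc n) / 2 ^ n * excess K x n l \<le> level_excess K x s t n"
proof -
  have "(if s \<le> dy n l \<and> dy n (Suc l) \<le> t then excess K x n l else 0) \<le>
    (\<Sum>l<2^n. if s \<le> dy n l \<and> dy n (Suc l) \<le> t then excess K x n l else 0)"
    using assms(1) by (intro member_le_sum) (auto simp: excess_nonneg)
  then show ?thesis unfolding level_excess_def using assms weight_pos[of "Suc n"]
    by (intro mult_left_mono) auto
qed

lemma level_excess_eq_0:
  assumes "t - s < 1 / 2 ^ n"
  shows "level_excess K x s t n = 0"
proof -
  have "\<not> (s \<le> dy n l \<and> dy n (Suc l) \<le> t)" for l using assms by (auto simp: dy_Suc)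
  then have "(\<Sum>l<2^n. if s \<le> dy n l \<and> dy n (Suc l) \<le> t then excess K x n l else 0) = 0"
    by (intro sum.neutral) auto
  then show ?thesis unfolding level_excess_def by simp
qed

lemma scale_bracket:
  fixes w :: real
  assumes "0 < w" "w \<le> 1"
  obtains p :: nat where "1 / 2 ^ Suc p < w" "w \<le> 1 / 2 ^ p"
proof -
  obtain n0 where "1 / w < 2 ^ n0" using real_arch_pow[of 2 "1/w"] by auto
  then have ex: "1 / 2 ^ n0 < w" using assms by (simp add: field_simps)
  define n where "n = (LEAST n. 1 / 2 ^ n < w)"
  have n: "1 / 2 ^ n < w" unfolding n_def by (rule LeastI[of _ n0]) (rule ex)
  have "n \<noteq> 0"
  proof
    assume "n = 0"
    then show False using n assms by simp
  qed
  then obtain p where p: "n = Suc p" by (cases n) auto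
  then have "\<not> 1 / 2 ^ p < w" using not_less_Least[of p "\<lambda>n. 1 / 2 ^ n < w"] n_def by auto
  then show thesis using that[of p] n p by auto
qed

section \<open>Estimates for a fixed tame path\<close>

context
  fixes K :: real and x :: "real \<Rightarrow> 'b::real_normed_vector"
  assumes K: "K > 0" and tame: "tame K x"
begin

lemma summable_level_excess: "0 \<le> s \<Longrightarrow> t \<le> 1 \<Longrightarrow> summable (level_excess K x s t)"
proof -
  assume "0 \<le> s" "t \<le> 1"
  then have le: "level_excess K x s t n \<le> level_excess K x 0 1 n" for n by (intro level_excess_mono)
  have "summable (level_excess K x 0 1)" using tame by (simp add: tame_def)
  then show ?thesis
    by (rule summable_comparison_test'[of _ 0]) (simp only: real_norm_def abs_of_nonneg[OF level_excess_nonneg] le)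
qed

lemma suminf_level_excess_mono:
  "0 \<le> s' \<Longrightarrow> s' \<le> s \<Longrightarrow> t \<le> t' \<Longrightarrow> t' \<le> 1 \<Longrightarrow>
    suminf (level_excess K x s t) \<le> suminf (level_excess K x s' t')"
  by (intro suminf_le level_excess_mono summable_level_excess) auto

lemma control_mono:
  "0 \<le> s' \<Longrightarrow> s' \<le> s \<Longrightarrow> t \<le> t' \<Longrightarrow> t' \<le> 1 \<Longrightarrow> control K x s t \<le> control K x s' t'"
  unfolding control_def by (intro add_mono divide_right_mono suminf_level_excess_mono) auto

lemma control_ge: "0 \<le> s \<Longrightarrow> t \<le> 1 \<Longrightarrow> (t - s) / 2 \<le> control K x s t"
  unfolding control_def using suminf_nonneg[OF summable_level_excess level_excess_nonneg] by simp

lemma control_nonneg: "0 \<le> s \<Longrightarrow> s \<le> t \<Longrightarrow> t \<le> 1 \<Longrightarrow> 0 \<le> control K x s t"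
  by (rule order_trans[OF _ control_ge]) auto

lemma control_le_one: "0 \<le> s \<Longrightarrow> t \<le> 1 \<Longrightarrow> control K x s t \<le> 1"
  using control_mono[of 0 s t 1] tame by (simp add: control_def tame_def)

lemma control_superadditive:
  assumes "0 \<le> a" "a \<le> b" "b \<le> c" "c \<le> 1"
  shows "control K x a b + control K x b c \<le> control K x a c"
proof -
  have "suminf (level_excess K x a b) + suminf (level_excess K x b c)
      = (\<Sum>n. level_excess K x a b n + level_excess K x b c n)"
    using assms by (intro suminf_add summable_level_excess) auto
  also have "\<dots> \<le> suminf (level_excess K x a c)"
    using assms by (intro suminf_le level_excess_superadditive summable_add summable_level_excess) auto
  finally show ?thesis by (simp add: control_def field_simps)
qed

text \<open>The core estimate. On the \<open>k\<close>-th admissible level the normalised increment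
  is at most a multiple of \<open>(2 powr \<alpha> * \<rho>) ^ k * \<Phi>inv H\<close>. Undoing the
  normalisation leaves \<open>C * \<rho> ^ k\<close>, so the sum over levels is geometric and its
  leading term is comparable to \<open>K * \<sigma> w\<close>.\<close>

lemma dyadic_increment_le:
  assumes ij: "i < j" "j \<le> 2 ^ N"
  shows "norm (x (dy N j) - x (dy N i)) \<le> K * chain_const * \<sigma> (control K x (dy N i) (dy N j))"
proof -
  define s t where "s = dy N i" and "t = dy N j"
  define w where "w = control K x s t"
  have st: "0 \<le> s" "s < t" "t \<le> 1"
    using ij dy_le_one[of j N] by (auto simp: s_def t_def dy_def divide_strict_right_mono)
  have w: "0 < w" "w \<le> 1" using control_ge[of s t] control_le_one[of s t] st by (auto simp: w_def)
  obtain p :: nat where p: "1 / 2 ^ Suc p < w" "w \<le> 1 / 2 ^ p" using scale_bracket[OF w] by blast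
  define H where "H = h (log_star (2 ^ p))"
  define B where "B = max (R\<^sup>2) (1 / \<Phi>inv \<eta>)"
  define a where "a = 2 powr \<alpha>"
  have H: "H > 0" "H \<ge> \<eta>" unfolding H_def by (rule h_log_star_pos h_log_star_ge)+
  have a: "a > 0" unfolding a_def by simp
  have B: "B > 0" unfolding B_def using R_gt by (auto simp: less_max_iff_disj)
  have G: "\<Phi>inv H > 0" using H by (simp add: \<Phi>inv_pos)
  define C where "C = K * B * A * \<Phi>inv H * a / a ^ p"
  \<comment> \<open>The value 0 on coarse levels is legitimate: no dyadic interval of such a level
    fits into \<open>[s,t]\<close>, as \<open>p \<le> Suc n\<close> in \<open>step\<close>
    shows.\<close>
  define D where "D n = (if Suc n < p then 0 else C * \<rho> ^ (Suc n - p))" for n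
  have C: "C > 0" unfolding C_def using K B A G a by simp
  have D0: "D n \<ge> 0" for n unfolding D_def using C \<rho> by simp
  have step: "norm (x (dy n (Suc l)) - x (dy n l)) \<le> D n"
    if l: "s \<le> dy n l" "dy n (Suc l) \<le> t" for n l
  proof -
    have "1 / 2 ^ n \<le> t - s" using l by (simp add: dy_Suc)
    then have "1 / 2 ^ Suc n \<le> w" using control_ge[of s t] st by (simp add: w_def)
    then have "(1::real) / 2 ^ Suc n \<le> 1 / 2 ^ p" using p by linarith
    then have "(2::real) ^ p \<le> 2 ^ Suc n" by (simp add: field_simps)
    then have "p \<le> Suc n" by (simp only: power_increasing_iff[of 2] one_less_numeral_iff semiring_norm)
    define k where "k = Suc n - p"
    have k: "Suc n = p + k" using \<open>p \<le> Suc n\<close> k_def by auto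
    have "dy n (Suc l) \<le> 1" using l st by linarith
    then have "real (Suc l) \<le> 2 ^ n" by (simp add: dy_def)
    then have l2: "l < 2 ^ n" by (simp add: Suc_le_eq flip: of_nat_Suc)
    define z where "z = incr K x n l"
    have z0: "z \<ge> 0" unfolding z_def incr_def using K by simp
    have "z \<le> max 1 (\<Phi>inv ((2 / \<theta>) ^ k * H))"
    proof (cases "z \<ge> 1")
      case True
      \<comment> \<open>The contribution of this one interval is already bounded by the whole
        control; solving for \<open>\<Phi> z\<close> gives the bound.\<close>
      have "weight (Suc n) / 2 ^ n * \<Phi> z \<le> level_excess K x s t n"
        using excess_le_level_excess[OF l2 l, of K x] True by (simp add: excess_def z_def)
      also have "\<dots> = sum (level_excess K x s t) {n}" by simp
      also have "\<dots> \<le> suminf (level_excess K x s t)"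
        using st by (intro sum_le_suminf summable_level_excess) (auto simp: level_excess_nonneg)
      also have "\<dots> \<le> w" using st by (simp add: w_def control_def)
      also have "\<dots> \<le> 1 / 2 ^ p" by (rule p)
      finally have *: "weight (Suc n) / 2 ^ n * \<Phi> z \<le> 1 / 2 ^ p" .
      have "\<theta> ^ k / H / 2 ^ n * \<Phi> z \<le> weight (Suc n) / 2 ^ n * \<Phi> z"
        using weight_lower[of k p] k z0 nonneg[of z] unfolding H_def
        by (intro mult_right_mono divide_right_mono) auto
      with * have "\<theta> ^ k / H / 2 ^ n * \<Phi> z \<le> 1 / 2 ^ p" by linarith
      then have "\<Phi> z \<le> 2 ^ n / 2 ^ p * H / \<theta> ^ k" using \<theta> H by (simp add: field_simps)
      also have "\<dots> \<le> 2 ^ Suc n / 2 ^ p * H / \<theta> ^ k"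
        using \<theta> H by (intro divide_right_mono mult_right_mono) auto
      also have "\<dots> = (2 / \<theta>) ^ k * H" unfolding k by (simp add: power_add power_divide)
      finally have "z \<le> \<Phi>inv ((2 / \<theta>) ^ k * H)" using z0 \<theta> H by (subst le_\<Phi>inv_iff) auto
      then show ?thesis by simp
    qed simp
    also have "(2 / \<theta>) ^ k \<ge> 1" using \<theta> by (intro one_le_power) auto
    then have "max 1 (\<Phi>inv ((2 / \<theta>) ^ k * H)) \<le> B * \<Phi>inv ((2 / \<theta>) ^ k) * \<Phi>inv H"
      unfolding B_def using \<eta> H by (intro max_\<Phi>inv_mult_le)
    also have "\<dots> \<le> B * (A * (a * \<rho>) ^ k) * \<Phi>inv H"
      using B G geom[of k] unfolding a_def by (intro mult_right_mono mult_left_mono) auto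
    finally have "z \<le> B * (A * (a * \<rho>) ^ k) * \<Phi>inv H" .
    moreover have "norm (x (dy n (Suc l)) - x (dy n l)) = K / a ^ n * z"
      unfolding z_def incr_def a_def using K by simp
    moreover have "K / a ^ n \<ge> 0" using K a by simp
    ultimately have le: "norm (x (dy n (Suc l)) - x (dy n l)) \<le> K / a ^ n * (B * (A * (a * \<rho>) ^ k) * \<Phi>inv H)"
      by (simp only: mult_left_mono)
    have "a ^ k * a ^ p = a * a ^ n" using k by (metis add.commute power_Suc power_add)
    then have "a ^ k / a ^ n = a / a ^ p" using a by (simp add: field_simps)
    moreover have "K / a ^ n * (B * (A * (a * \<rho>) ^ k) * \<Phi>inv H) = K * B * A * \<Phi>inv H * \<rho> ^ k * (a ^ k / a ^ n)"
      by (simp add: power_mult_distrib)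
    ultimately have "K / a ^ n * (B * (A * (a * \<rho>) ^ k) * \<Phi>inv H) = C * \<rho> ^ k"
      by (simp add: C_def)
    also have "\<dots> = D n" using \<open>p \<le> Suc n\<close> by (simp add: D_def k_def)
    finally show ?thesis using le by simp
  qed
  \<comment> \<open>The lower bound \<open>2^-(p+1) < w\<close> handles the power at the cost of one
    factor \<open>a\<close>; the upper bound \<open>w \<le> 2^-p\<close> lets the monotone
    \<open>h\<close> pass from scale \<open>2 ^ p\<close> to \<open>1 / w\<close>.\<close>
  have level: "\<Phi>inv H / a ^ p \<le> a * \<sigma> w"
  proof -
    have le: "(1 / 2 ^ Suc p) powr \<alpha> \<le> w powr \<alpha>" using p \<alpha> by (intro powr_mono2) auto
    have eq: "(1 / 2 ^ Suc p) powr \<alpha> = 1 / a ^ Suc p"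
      unfolding a_def by (simp only: powr_divide powr_one_eq_one powr_power powr_powr flip: powr_realpow)
    have "a * (1 / a ^ Suc p) \<le> a * w powr \<alpha>" using le a unfolding eq by (intro mult_left_mono) auto
    then have "1 / a ^ p \<le> a * w powr \<alpha>" using a by simp
    moreover have "2 ^ p \<le> 1 / w" using p w by (simp add: field_simps)
    then have "\<Phi>inv H \<le> \<Phi>inv (h (log_star (1 / w)))"
      unfolding H_def by (intro \<Phi>inv_mono h_log_star_mono less_imp_le[OF h_log_star_pos]) auto
    ultimately have "1 / a ^ p * \<Phi>inv H \<le> a * w powr \<alpha> * \<Phi>inv (h (log_star (1 / w)))"
      using a G by (intro mult_mono) auto
    then show ?thesis by (simp add: sigma_fn_def)
  qed
  have "norm (x (dy N j) - x (dy N i)) \<le> 2 * (\<Sum>n\<le>N. D n)"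
    using ij step by (intro dyadic_chaining D0) (auto simp: s_def t_def)
  also have "(\<Sum>n\<le>N. D n) \<le> C * (1 / (1 - \<rho>))"
  proof -
    have "(\<Sum>n\<le>N. D n) = (\<Sum>n\<in>{n. n \<le> N \<and> p \<le> Suc n}. C * \<rho> ^ (Suc n - p))"
      unfolding D_def by (rule sum.mono_neutral_cong_right) auto
    also have "\<dots> = C * (\<Sum>n\<in>{n. n \<le> N \<and> p \<le> Suc n}. \<rho> ^ (Suc n - p))"
      by (simp add: sum_distrib_left)
    also have "(\<Sum>n\<in>{n. n \<le> N \<and> p \<le> Suc n}. \<rho> ^ (Suc n - p)) =
      (\<Sum>k\<in>(\<lambda>n. Suc n - p) ` {n. n \<le> N \<and> p \<le> Suc n}. \<rho> ^ k)"
      by (subst sum.reindex) (auto intro!: inj_onI)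
    also have "\<dots> \<le> (\<Sum>k. \<rho> ^ k)"
      using \<rho> by (intro sum_le_suminf) (auto simp: summable_geometric)
    also have "\<dots> = 1 / (1 - \<rho>)" using \<rho> by (intro suminf_geometric) auto
    finally show ?thesis using C by simp
  qed
  also have "2 * (C * (1 / (1 - \<rho>))) = 2 * K * B * A * a / (1 - \<rho>) * (\<Phi>inv H / a ^ p)"
    by (simp add: C_def mult_ac)
  also have "\<dots> \<le> 2 * K * B * A * a / (1 - \<rho>) * (a * \<sigma> w)"
    using level K B A a \<rho> by (intro mult_left_mono) auto
  also have "\<dots> = K * chain_const * \<sigma> w"
    unfolding chain_const_def B_def a_def by (simp add: power2_eq_square)
  finally show ?thesis by (simp add: w_def s_def t_def)
qed

text \<open>On a short interval the control is small: the coarse levels vanish because none of their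
  intervals fits, the remaining ones form a tail of one fixed convergent series. Then
  \<open>\<sigma>\<close> tends to 0 at 0.\<close>

lemma dyadic_uniformly_continuous:
  assumes "\<epsilon> > 0"
  obtains \<delta> where "\<delta> > 0"
    "\<And>N i j. i \<le> j \<Longrightarrow> j \<le> 2 ^ N \<Longrightarrow> dy N j - dy N i < \<delta> \<Longrightarrow> norm (x (dy N j) - x (dy N i)) \<le> \<epsilon>"
proof -
  define e where "e = \<epsilon> / (K * chain_const)"
  have "e > 0" unfolding e_def using assms K chain_const_pos by simp
  then have "\<forall>\<^sub>F t in at_right 0. \<sigma> t < e" using order_tendstoD(2)[OF \<sigma>_lim] by blast
  then obtain b where "b > 0" and b: "\<And>t. 0 < t \<Longrightarrow> t < b \<Longrightarrow> \<sigma> t < e"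
    unfolding eventually_at_right_field by auto
  have "summable (level_excess K x 0 1)" using tame by (simp add: tame_def)
  then obtain m where m: "norm (\<Sum>n. level_excess K x 0 1 (n + m)) < b / 2"
    using suminf_exist_split[of "b/2" "level_excess K x 0 1"] \<open>b > 0\<close> by auto
  define \<delta> where "\<delta> = min b (1 / 2 ^ m)"
  have "\<delta> > 0" unfolding \<delta>_def using \<open>b > 0\<close> by simp
  moreover have "norm (x (dy N j) - x (dy N i)) \<le> \<epsilon>"
    if ij: "i \<le> j" "j \<le> 2 ^ N" "dy N j - dy N i < \<delta>" for N i j
  proof (cases "i = j")
    case True
    then show ?thesis using assms by simp
  next
    case False
    define s t where "s = dy N i" and "t = dy N j"
    have st: "0 \<le> s" "s < t" "t \<le> 1" "t - s < \<delta>"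
      using ij False dy_le_one[of j N] by (auto simp: s_def t_def dy_def divide_strict_right_mono)
    have sm: "summable (level_excess K x s t)" using st by (intro summable_level_excess)
    have "level_excess K x s t n = 0" if "n < m" for n
    proof (rule level_excess_eq_0)
      have "(1::real) / 2 ^ m \<le> 1 / 2 ^ n" using that by (intro divide_left_mono power_increasing) auto
      then show "t - s < 1 / 2 ^ n" using st unfolding \<delta>_def by linarith
    qed
    then have "suminf (level_excess K x s t) = (\<Sum>n. level_excess K x s t (n + m))"
      using suminf_split_initial_segment[OF sm, of m] by simp
    also have "\<dots> \<le> (\<Sum>n. level_excess K x 0 1 (n + m))"
      using st tame sm by (intro suminf_le level_excess_mono) (auto simp: tame_def summable_iff_shift)
    also have "\<dots> < b / 2" using m by auto
    finally have "suminf (level_excess K x s t) < b / 2" .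
    moreover have "(t - s) / 2 < b / 2" using st unfolding \<delta>_def by simp
    ultimately have "control K x s t < b" unfolding control_def by linarith
    moreover have "control K x s t > 0" using control_ge[of s t] st by auto
    ultimately have "\<sigma> (control K x s t) \<le> e" using b by (intro less_imp_le) auto
    then have "K * chain_const * \<sigma> (control K x s t) \<le> K * chain_const * e"
      using K chain_const_pos by (intro mult_left_mono) auto
    also have "\<dots> = \<epsilon>" unfolding e_def using K chain_const_pos by simp
    finally show ?thesis using dyadic_increment_le[of i j N] ij False by (auto simp: s_def t_def)
  qed
  ultimately show thesis using that by blast
qed

end

end

section \<open>Variation of continuous paths\<close>

definition dy_below :: "nat \<Rightarrow> real \<Rightarrow> nat" where
  "dy_below n t = nat \<lfloor>t * 2 ^ n\<rfloor>"

definition dy_above :: "nat \<Rightarrow> real \<Rightarrow> nat" where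
  "dy_above n t = nat \<lceil>t * 2 ^ n\<rceil>"

lemma dy_dy_below:
  assumes "0 \<le> t"
  shows "dy n (dy_below n t) \<le> t" "t - 1 / 2 ^ n \<le> dy n (dy_below n t)"
proof -
  define a where "a = t * 2 ^ n"
  have "a \<ge> 0" using assms by (simp add: a_def)
  then have *: "real (dy_below n t) = of_int \<lfloor>a\<rfloor>" by (simp add: dy_below_def a_def)
  have t: "a / 2 ^ n = t" by (simp add: a_def)
  have "of_int \<lfloor>a\<rfloor> / 2 ^ n \<le> a / 2 ^ n" by (intro divide_right_mono) auto
  then show "dy n (dy_below n t) \<le> t" unfolding dy_def * t .
  have "a - 1 \<le> of_int \<lfloor>a\<rfloor>" by linarith
  then have "(a - 1) / 2 ^ n \<le> of_int \<lfloor>a\<rfloor> / 2 ^ n" by (intro divide_right_mono) auto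
  then show "t - 1 / 2 ^ n \<le> dy n (dy_below n t)"
    unfolding dy_def * diff_divide_distrib t .
qed

lemma dy_dy_above:
  assumes "0 \<le> t"
  shows "t \<le> dy n (dy_above n t)" "dy n (dy_above n t) \<le> t + 1 / 2 ^ n"
proof -
  define a where "a = t * 2 ^ n"
  have "a \<ge> 0" using assms by (simp add: a_def)
  then have *: "real (dy_above n t) = of_int \<lceil>a\<rceil>" by (simp add: dy_above_def a_def)
  have t: "a / 2 ^ n = t" by (simp add: a_def)
  have "a / 2 ^ n \<le> of_int \<lceil>a\<rceil> / 2 ^ n" by (intro divide_right_mono) auto
  then show "t \<le> dy n (dy_above n t)" unfolding dy_def * t .
  have "of_int \<lceil>a\<rceil> \<le> a + 1" by linarith
  then have "of_int \<lceil>a\<rceil> / 2 ^ n \<le> (a + 1) / 2 ^ n" by (intro divide_right_mono) auto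
  then show "dy n (dy_above n t) \<le> t + 1 / 2 ^ n"
    unfolding dy_def * add_divide_distrib t .
qed

lemma dy_below_le: "t \<le> 1 \<Longrightarrow> dy_below n t \<le> 2 ^ n"
proof -
  assume "t \<le> 1"
  then have "t * 2 ^ n \<le> real (2 ^ n)" by simp
  then have "\<lfloor>t * 2 ^ n\<rfloor> \<le> \<lfloor>real (2 ^ n)\<rfloor>" by (rule floor_mono)
  then show ?thesis unfolding dy_below_def floor_of_nat by (simp add: nat_le_iff)
qed

lemma dy_above_le: "t \<le> 1 \<Longrightarrow> dy_above n t \<le> 2 ^ n"
proof -
  assume "t \<le> 1"
  then have "t * 2 ^ n \<le> real (2 ^ n)" by simp
  then have "\<lceil>t * 2 ^ n\<rceil> \<le> \<lceil>real (2 ^ n)\<rceil>" by (rule ceiling_mono)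
  then show ?thesis unfolding dy_above_def ceiling_of_nat by (simp add: nat_le_iff)
qed

lemma tendsto_inverse_power2: "(\<lambda>n. 1 / 2 ^ n :: real) \<longlonglongrightarrow> 0"
  using LIMSEQ_power_zero[of "1 / 2 :: real"] by (simp add: power_one_over)

lemma tendsto_dy_below: "0 \<le> t \<Longrightarrow> (\<lambda>n. dy n (dy_below n t)) \<longlonglongrightarrow> t"
  by (rule tendsto_sandwich[of "\<lambda>n. t - 1 / 2 ^ n" _ _ "\<lambda>n. t"])
     (use dy_dy_below tendsto_diff[OF tendsto_const tendsto_inverse_power2, of t] in auto)

lemma tendsto_dy_above: "0 \<le> t \<Longrightarrow> (\<lambda>n. dy n (dy_above n t)) \<longlonglongrightarrow> t"
  by (rule tendsto_sandwich[of "\<lambda>n. t" _ _ "\<lambda>n. t + 1 / 2 ^ n"])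
     (use dy_dy_above tendsto_add[OF tendsto_const tendsto_inverse_power2, of t] in auto)

text \<open>Two limits: rounding both points to a common level carries the modulus from the dyadics
  to \<open>T\<close>, and \<open>sep\<close> carries it from \<open>T\<close> to the unit interval
  by choosing nearby points of \<open>T\<close> whose values are close as well. The errors add up to
  less than \<open>3 * e < \<epsilon>\<close>.\<close>

lemma continuous_on_of_dyadics:
  fixes x :: "real \<Rightarrow> 'b::real_normed_vector"
  assumes unif: "\<And>\<epsilon>. \<epsilon> > 0 \<Longrightarrow> \<exists>\<delta>>0. \<forall>N i j. i \<le> j \<longrightarrow> j \<le> 2 ^ N \<longrightarrow> dy N j - dy N i < \<delta> \<longrightarrow>
      norm (x (dy N j) - x (dy N i)) \<le> \<epsilon>"
    and T: "T \<subseteq> {0..1}" "\<And>t. t \<in> T \<Longrightarrow> (\<lambda>n. x (dy n (dy_below n t))) \<longlonglongrightarrow> x t"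
    and sep: "\<And>t \<epsilon>. t \<in> {0..1} \<Longrightarrow> \<epsilon> > 0 \<Longrightarrow> x t \<in> closure (x ` {s\<in>T. \<bar>s - t\<bar> < \<epsilon>})"
  shows "continuous_on {0..1} x"
  unfolding continuous_on_iff
proof (intro ballI allI impI)
  fix t \<epsilon> :: real
  assume t: "t \<in> {0..1}" and "\<epsilon> > 0"
  define e where "e = \<epsilon> / 4"
  have e: "e > 0" using \<open>\<epsilon> > 0\<close> by (simp add: e_def)
  obtain \<delta> where "\<delta> > 0" and \<delta>: "\<And>N i j. i \<le> j \<Longrightarrow> j \<le> 2 ^ N \<Longrightarrow> dy N j - dy N i < \<delta> \<Longrightarrow>
      norm (x (dy N j) - x (dy N i)) \<le> e"
    using unif[OF e] by blast
  have D: "norm (x (dy N j) - x (dy N i)) \<le> e"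
    if "i \<le> 2 ^ N" "j \<le> 2 ^ N" "\<bar>dy N j - dy N i\<bar> < \<delta>" for N i j
    using \<delta>[of i j N] \<delta>[of j i N] that by (cases "i \<le> j") (auto simp: norm_minus_commute)
  have onT: "norm (x s - x r) \<le> e" if "s \<in> T" "r \<in> T" "\<bar>s - r\<bar> < \<delta>" for s r
  proof -
    have sr: "s \<in> {0..1}" "r \<in> {0..1}" using that T by auto
    have "(\<lambda>n. norm (x (dy n (dy_below n s)) - x (dy n (dy_below n r)))) \<longlonglongrightarrow> norm (x s - x r)"
      using that by (intro tendsto_norm tendsto_diff T)
    moreover have "(\<lambda>n. \<bar>dy n (dy_below n s) - dy n (dy_below n r)\<bar>) \<longlonglongrightarrow> \<bar>s - r\<bar>"
      using sr by (intro tendsto_rabs tendsto_diff tendsto_dy_below) auto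
    then have "\<forall>\<^sub>F n in sequentially. \<bar>dy n (dy_below n s) - dy n (dy_below n r)\<bar> < \<delta>"
      using that by (auto dest: order_tendstoD)
    then have "\<forall>\<^sub>F n in sequentially. norm (x (dy n (dy_below n s)) - x (dy n (dy_below n r))) \<le> e"
      by (rule eventually_mono) (use sr in \<open>auto intro!: D dy_below_le\<close>)
    ultimately show ?thesis by (intro tendsto_upperbound[where F = sequentially]) auto
  qed
  have near: "\<exists>s'\<in>T. \<bar>s' - s\<bar> < \<delta> / 3 \<and> dist (x s') (x s) < e" if "s \<in> {0..1}" for s
    using sep[OF that, of "\<delta> / 3"] \<open>\<delta> > 0\<close> e unfolding closure_approachable by fastforce
  show "\<exists>d>0. \<forall>s\<in>{0..1}. dist s t < d \<longrightarrow> dist (x s) (x t) < \<epsilon>"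
  proof (intro exI[of _ "\<delta> / 3"] conjI ballI impI)
    show "\<delta> / 3 > 0" using \<open>\<delta> > 0\<close> by simp
    fix s assume s: "s \<in> {0..1}" "dist s t < \<delta> / 3"
    obtain s' where s': "s' \<in> T" "\<bar>s' - s\<bar> < \<delta> / 3" "dist (x s') (x s) < e" using near s by blast
    obtain t' where t': "t' \<in> T" "\<bar>t' - t\<bar> < \<delta> / 3" "dist (x t') (x t) < e" using near t by blast
    have "\<bar>s' - t'\<bar> < \<delta>" using s(2) s'(2) t'(2) unfolding dist_real_def by linarith
    then have "dist (x s') (x t') \<le> e" using onT s' t' by (simp add: dist_norm)
    then have "dist (x s) (x t) < 3 * e"
      using s'(3) t'(3) dist_triangle[of "x s" "x t" "x s'"] dist_triangle[of "x s'" "x t" "x t'"]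
      by (simp add: dist_commute)
    then show "dist (x s) (x t) < \<epsilon>" using e by (simp add: e_def)
  qed
qed

context gauge
begin

text \<open>Rounding \<open>s\<close> up and \<open>t\<close> down keeps the dyadic intervals inside
  \<open>[s,t]\<close>, so monotonicity of the control bounds all of them by the same quantity; no
  continuity of the control is involved.\<close>

lemma tame_increment_le:
  fixes x :: "real \<Rightarrow> 'b::real_normed_vector"
  assumes K: "K > 0" "tame K x" and cont: "continuous_on {0..1} x" and st: "0 \<le> s" "s < t" "t \<le> 1"
  shows "norm (x t - x s) \<le> K * chain_const * \<sigma> (control K x s t)"
proof -
  define sn tn where "sn n = dy n (dy_above n s)" and "tn n = dy n (dy_below n t)" for n
  have lim: "sn \<longlonglongrightarrow> s" "tn \<longlonglongrightarrow> t"
    unfolding sn_def tn_def using st by (auto intro: tendsto_dy_above tendsto_dy_below)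
  have mem: "sn n \<in> {0..1}" "tn n \<in> {0..1}" for n
    using st dy_le_one dy_above_le dy_below_le by (auto simp: sn_def tn_def)
  have in01: "\<forall>\<^sub>F n in sequentially. sn n \<in> {0..1}" "\<forall>\<^sub>F n in sequentially. tn n \<in> {0..1}" using mem by simp_all
  have "(\<lambda>n. x (sn n)) \<longlonglongrightarrow> x s" "(\<lambda>n. x (tn n)) \<longlonglongrightarrow> x t"
    using continuous_on_tendsto_compose[OF cont lim(1) _ in01(1)] continuous_on_tendsto_compose[OF cont lim(2) _ in01(2)] st
    by auto
  then have "(\<lambda>n. norm (x (tn n) - x (sn n))) \<longlonglongrightarrow> norm (x t - x s)"
    by (intro tendsto_norm tendsto_diff)
  moreover have "\<forall>\<^sub>F n in sequentially. sn n < (s + t) / 2" "\<forall>\<^sub>F n in sequentially. (s + t) / 2 < tn n"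
    using order_tendstoD(2)[OF lim(1), of "(s + t) / 2"] order_tendstoD(1)[OF lim(2), of "(s + t) / 2"] st by simp_all
  then have "\<forall>\<^sub>F n in sequentially. norm (x (tn n) - x (sn n)) \<le> K * chain_const * \<sigma> (control K x s t)"
  proof eventually_elim
    case (elim n)
    then have "sn n < tn n" by linarith
    then have lt: "dy_above n s < dy_below n t"
      using dy_mono[of "dy_below n t" "dy_above n s" n] unfolding sn_def tn_def by (meson leD not_less)
    have "norm (x (tn n) - x (sn n)) \<le> K * chain_const * \<sigma> (control K x (sn n) (tn n))"
      unfolding sn_def tn_def using lt st by (intro dyadic_increment_le K dy_below_le) auto
    also have "\<dots> \<le> K * chain_const * \<sigma> (control K x s t)"
    proof -
      have "control K x (sn n) (tn n) \<le> control K x s t"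
        using st dy_dy_above(1)[of s n] dy_dy_below(1)[of t n]
        by (intro control_mono[OF K]) (auto simp: sn_def tn_def)
      moreover have "control K x (sn n) (tn n) \<ge> 0"
        using mem[of n] \<open>sn n < tn n\<close> by (intro control_nonneg[OF K]) auto
      ultimately show ?thesis
        using K chain_const_pos by (intro mult_left_mono \<sigma>_monotone) auto
    qed
    finally show ?case .
  qed
  ultimately show ?thesis by (intro tendsto_upperbound[where F = sequentially]) auto
qed

text \<open>\<open>\<psi>\<close> undoes \<open>\<sigma>\<close>, so each summand is at most the
  control of its interval; superadditivity collapses the sum to one control, which is at most
  1.\<close>

lemma psi_var_le:
  fixes x :: "real \<Rightarrow> 'b::real_normed_vector"
  assumes K: "K > 0" "tame K x" and cont: "continuous_on {0..1} x"
  shows "psi_var \<psi> x \<le> ereal (K * chain_const)"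
proof -
  have kc: "K * chain_const > 0" using K chain_const_pos by simp
  have "(\<Sum>i<r. \<psi> (norm (x (t (Suc i)) - x (t i)) / (K * chain_const))) \<le> 1"
    if t: "(r, t) \<in> partitions" for r t
  proof -
    have mem: "t i \<in> {0..1}" if "i \<le> r" for i using t that by (auto simp: partitions_def)
    have less: "t i < t j" if "i < j" "j \<le> r" for i j
      using t that by (auto simp: partitions_def intro: strict_mono_onD)
    have le: "t i \<le> t j" if "i \<le> j" "j \<le> r" for i j using less[of i j] that by (cases "i = j") auto
    have "(\<Sum>i<r. \<psi> (norm (x (t (Suc i)) - x (t i)) / (K * chain_const))) \<le> (\<Sum>i<r. control K x (t i) (t (Suc i)))"
    proof (rule sum_mono)
      fix i assume i: "i \<in> {..<r}"
      have m: "0 \<le> t i" "t i < t (Suc i)" "t (Suc i) \<le> 1"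
        using mem[of i] mem[of "Suc i"] less[of i "Suc i"] i by auto
      have "norm (x (t (Suc i)) - x (t i)) \<le> K * chain_const * \<sigma> (control K x (t i) (t (Suc i)))"
        by (rule tame_increment_le[OF K cont m])
      then have "norm (x (t (Suc i)) - x (t i)) / (K * chain_const) \<le> \<sigma> (control K x (t i) (t (Suc i)))"
        using kc by (simp add: pos_divide_le_eq mult.commute)
      moreover have "control K x (t i) (t (Suc i)) \<ge> 0"
        using m by (intro control_nonneg[OF K]) auto
      ultimately show "\<psi> (norm (x (t (Suc i)) - x (t i)) / (K * chain_const)) \<le> control K x (t i) (t (Suc i))"
        using kc by (intro \<psi>_le) auto
    qed
    also have "\<dots> \<le> control K x (t 0) (t r)"
    proof -
      have "(\<Sum>i<m. control K x (t i) (t (Suc i))) \<le> control K x (t 0) (t m)" if "m \<le> r" for m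
        using that
      proof (induction m)
        case 0
        then show ?case using control_ge[OF K, of "t 0" "t 0"] mem[of 0] by simp
      next
        case (Suc m)
        have "control K x (t 0) (t m) + control K x (t m) (t (Suc m)) \<le> control K x (t 0) (t (Suc m))"
          using Suc.prems mem[of 0] mem[of "Suc m"] le[of 0 m] le[of m "Suc m"]
          by (intro control_superadditive[OF K]) auto
        then show ?case using Suc by simp
      qed
      then show ?thesis by simp
    qed
    also have "\<dots> \<le> 1" using mem[of 0] mem[of r] by (intro control_le_one[OF K]) auto
    finally show ?thesis .
  qed
  then have "(SUP (r, t)\<in>partitions. ereal (\<Sum>i<r. \<psi> (norm (x (t (Suc i)) - x (t i)) / (K * chain_const)))) \<le> 1"
    by (intro SUP_least) (auto simp: one_ereal_def)
  then show ?thesis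
    unfolding psi_var_def using kc by (intro Inf_lower) blast
qed

lemma tame_continuous:
  fixes x :: "real \<Rightarrow> 'b::real_normed_vector"
  assumes K: "K > 0" "tame K x"
    and T: "T \<subseteq> {0..1}" "\<And>t. t \<in> T \<Longrightarrow> (\<lambda>n. x (dy n (dy_below n t))) \<longlonglongrightarrow> x t"
    and sep: "\<And>t \<epsilon>. t \<in> {0..1} \<Longrightarrow> \<epsilon> > 0 \<Longrightarrow> x t \<in> closure (x ` {s\<in>T. \<bar>s - t\<bar> < \<epsilon>})"
  shows "continuous_on {0..1} x"
proof (rule continuous_on_of_dyadics[OF _ T sep])
  fix \<epsilon> :: real assume "\<epsilon> > 0"
  from dyadic_uniformly_continuous[OF K this]
  show "\<exists>\<delta>>0. \<forall>N i j. i \<le> j \<longrightarrow> j \<le> 2 ^ N \<longrightarrow> dy N j - dy N i < \<delta> \<longrightarrow>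
      norm (x (dy N j) - x (dy N i)) \<le> \<epsilon>" by metis
qed

text \<open>For continuous paths the variation constant is determined by the dyadic partitions, which
  are countably many.\<close>

lemma psi_var_gt_iff:
  fixes x :: "real \<Rightarrow> 'b::real_normed_vector"
  assumes cont: "continuous_on {0..1} x" and M: "M > 0"
  shows "psi_var \<psi> x > ereal M \<longleftrightarrow>
    (\<exists>(q::rat) (n::nat) (js::nat list). of_rat q > M \<and> js \<noteq> [] \<and> sorted_wrt (<) js \<and> set js \<subseteq> {..2 ^ n} \<and>
      (\<Sum>i<length js - 1. \<psi> (norm (x (dy n (js ! Suc i)) - x (dy n (js ! i))) / of_rat q)) > 1)"
    (is "_ \<longleftrightarrow> ?R")
proof -
  define S where "S c r t = (\<Sum>i<r. \<psi> (norm (x (t (Suc i)) - x (t i)) / c))" for c r and t :: "nat \<Rightarrow> real"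
  have anti: "S d r t \<le> S c r t" if "0 < c" "c \<le> d" for c d r t
    unfolding S_def using that by (intro sum_mono \<psi>_mono divide_left_mono) auto
  have var: "psi_var \<psi> x = Inf {ereal c |c. c > 0 \<and> (SUP (r, t)\<in>partitions. ereal (S c r t)) \<le> 1}"
    unfolding psi_var_def S_def ..
  show ?thesis
  proof
    assume "psi_var \<psi> x > ereal M"
    then obtain z where z: "ereal M < z" "z < psi_var \<psi> x" using dense by blast
    then obtain y where y: "z = ereal y" by (cases z) auto
    then have "M < y" using z by simp
    \<comment> \<open>A rational scale keeps the family countable, and its strict distance from
      \<open>M\<close> is what the converse uses to recover a strict inequality for the
      infimum.\<close>
    then obtain q where q: "M < of_rat q" "of_rat q < y" using of_rat_dense by blast
    have q0: "of_rat q > (0::real)" using q M by linarith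
    have "\<not> (SUP (r, t)\<in>partitions. ereal (S (of_rat q) r t)) \<le> 1"
    proof
      assume "(SUP (r, t)\<in>partitions. ereal (S (of_rat q) r t)) \<le> 1"
      then have "psi_var \<psi> x \<le> ereal (of_rat q)" unfolding var using q0 by (intro Inf_lower) auto
      then have "ereal y < ereal (of_rat q)" using z y by (metis less_le_trans)
      then show False using q by simp
    qed
    then obtain r t where rt: "(r, t) \<in> partitions" "S (of_rat q) r t > 1"
      unfolding SUP_le_iff by (auto simp: not_le one_ereal_def)
    have mem: "t i \<in> {0..1}" if "i \<le> r" for i using rt that by (auto simp: partitions_def)
    have less: "t i < t j" if "i < j" "j \<le> r" for i j
      using rt that by (auto simp: partitions_def intro: strict_mono_onD)
    \<comment> \<open>The partition is rounded to level \<open>n\<close>. For large \<open>n\<close>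
      the points stay strictly increasing and, by continuity of \<open>x\<close> and
      \<open>\<psi>\<close>, the sum stays above 1.\<close>
    define tn where "tn n i = dy n (dy_below n (t i))" for n i
    have lim: "(\<lambda>n. tn n i) \<longlonglongrightarrow> t i" if "i \<le> r" for i
      unfolding tn_def using mem[OF that] by (intro tendsto_dy_below) auto
    have mem': "tn n i \<in> {0..1}" if "i \<le> r" for n i
      using mem[OF that] dy_le_one dy_below_le by (auto simp: tn_def)
    have limx: "(\<lambda>n. x (tn n i)) \<longlonglongrightarrow> x (t i)" if "i \<le> r" for i
      by (rule continuous_on_tendsto_compose[OF cont lim[OF that] mem[OF that]]) (use mem'[OF that] in simp)
    have "(\<lambda>n. S (of_rat q) r (tn n)) \<longlonglongrightarrow> S (of_rat q) r t"
      unfolding S_def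
    proof (rule tendsto_sum)
      fix i assume i: "i \<in> {..<r}"
      have "(\<lambda>n. norm (x (tn n (Suc i)) - x (tn n i)) / of_rat q) \<longlonglongrightarrow> norm (x (t (Suc i)) - x (t i)) / of_rat q"
        using i q0 by (intro tendsto_intros limx) auto
      then show "(\<lambda>n. \<psi> (norm (x (tn n (Suc i)) - x (tn n i)) / of_rat q)) \<longlonglongrightarrow> \<psi> (norm (x (t (Suc i)) - x (t i)) / of_rat q)"
        by (rule continuous_on_tendsto_compose[OF continuous_\<psi>]) (use q0 in auto)
    qed
    then have ev1: "\<forall>\<^sub>F n in sequentially. S (of_rat q) r (tn n) > 1"
      using rt(2) by (rule order_tendstoD)
    have ev2: "\<forall>\<^sub>F n in sequentially. \<forall>i\<in>{..<r}. tn n i < tn n (Suc i)"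
    proof (rule eventually_ball_finite, simp, intro ballI)
      fix i assume i: "i \<in> {..<r}"
      have "(\<lambda>n. tn n (Suc i) - tn n i) \<longlonglongrightarrow> t (Suc i) - t i" using i by (intro tendsto_diff lim) auto
      then have "\<forall>\<^sub>F n in sequentially. tn n (Suc i) - tn n i > 0"
        by (rule order_tendstoD) (use i less[of i "Suc i"] in auto)
      then show "\<forall>\<^sub>F n in sequentially. tn n i < tn n (Suc i)" by (rule eventually_mono) simp
    qed
    have "\<forall>\<^sub>F n in sequentially. S (of_rat q) r (tn n) > 1 \<and> (\<forall>i\<in>{..<r}. tn n i < tn n (Suc i))"
      using ev1 ev2 by (rule eventually_conj)
    then obtain n where n: "S (of_rat q) r (tn n) > 1" "\<And>i. i < r \<Longrightarrow> tn n i < tn n (Suc i)"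
      unfolding eventually_sequentially by auto
    define js where "js = map (\<lambda>i. dy_below n (t i)) [0..<Suc r]"
    have len: "length js = Suc r" by (simp add: js_def)
    have nth: "js ! i = dy_below n (t i)" if "i \<le> r" for i
      using that unfolding js_def by (subst nth_map) (auto simp del: upt_Suc)
    have "js ! i < js ! Suc i" if "Suc i < length js" for i
    proof -
      have i: "i < r" using that len by simp
      then have "\<not> dy n (dy_below n (t (Suc i))) \<le> dy n (dy_below n (t i))" using n(2) by (simp add: tn_def not_le)
      then have "\<not> dy_below n (t (Suc i)) \<le> dy_below n (t i)" using dy_mono by blast
      then show ?thesis using nth[of i] nth[of "Suc i"] i by simp
    qed
    then have "sorted_wrt (<) js" by (subst sorted_wrt_iff_nth_Suc_transp) (auto simp: transp_def)
    moreover have "set js \<subseteq> {..2 ^ n}"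
      using mem dy_below_le unfolding js_def by (auto simp del: upt_Suc)
    moreover have "(\<Sum>i<length js - 1. \<psi> (norm (x (dy n (js ! Suc i)) - x (dy n (js ! i))) / of_rat q)) = S (of_rat q) r (tn n)"
      unfolding S_def len tn_def by (intro sum.cong) (auto simp: nth)
    moreover have "js \<noteq> []" using len by auto
    ultimately show ?R using n(1) q(1) by (intro exI[of _ q] exI[of _ n] exI[of _ js]) auto
  next
    assume ?R
    then obtain q :: rat and n js where q: "of_rat q > M" and js: "js \<noteq> []" "sorted_wrt (<) js" "set js \<subseteq> {..2 ^ n}"
      and gt: "(\<Sum>i<length js - 1. \<psi> (norm (x (dy n (js ! Suc i)) - x (dy n (js ! i))) / of_rat q)) > 1"
      by blast
    define r where "r = length js - 1"
    define t where "t i = dy n (js ! i)" for i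
    have len: "length js = Suc r" using js by (simp add: r_def)
    have "(r, t) \<in> partitions"
    proof -
      have "strict_mono_on {..r} t"
      proof (rule strict_mono_onI)
        fix i j assume "i \<in> {..r}" "j \<in> {..r}" "i < j"
        then have "js ! i < js ! j" using js(2) len by (simp add: sorted_wrt_iff_nth_less)
        then show "t i < t j" by (simp add: t_def dy_def divide_strict_right_mono)
      qed
      moreover have "t i \<in> {0..1}" if "i \<le> r" for i
      proof -
        have "js ! i \<le> 2 ^ n" using subsetD[OF js(3) nth_mem[of i js]] len that by simp
        then show ?thesis by (simp add: t_def dy_le_one)
      qed
      ultimately show ?thesis by (auto simp: partitions_def)
    qed
    moreover have "S (of_rat q) r t > 1" using gt by (simp add: S_def r_def t_def)
    \<comment> \<open>The sums decrease in the scale, so a violation at \<open>q\<close> excludes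
      every smaller scale and the infimum is at least \<open>q\<close>.\<close>
    ultimately have big: "\<not> (SUP (r, t)\<in>partitions. ereal (S c r t)) \<le> 1" if "0 < c" "c \<le> of_rat q" for c
    proof -
      have "1 < S c r t" using anti[of c "of_rat q" r t] that \<open>S (of_rat q) r t > 1\<close> by linarith
      then show ?thesis using \<open>(r, t) \<in> partitions\<close>
        unfolding SUP_le_iff by (auto simp: one_ereal_def not_le intro!: bexI[of _ "(r, t)"])
    qed
    have "ereal (of_rat q) \<le> psi_var \<psi> x"
      unfolding var
    proof (rule Inf_greatest)
      fix z assume "z \<in> {ereal c |c. c > 0 \<and> (SUP (r, t)\<in>partitions. ereal (S c r t)) \<le> 1}"
      then obtain c where c: "z = ereal c" "c > 0" "(SUP (r, t)\<in>partitions. ereal (S c r t)) \<le> 1" by blast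
      then show "ereal (of_rat q) \<le> z" using big[of c] by force
    qed
    then show "ereal M < psi_var \<psi> x" using q by (metis less_ereal.simps(1) less_le_trans)
  qed
qed

end

section \<open>Tail of the variation of a process\<close>

text \<open>In a nonseparable Banach space the difference of Borel functions need not be Borel. Here
  the countable dense set helps: the distance is below \<open>a\<close> iff a detour through some
  \<open>d\<close> in \<open>D\<close> is.\<close>

lemma borel_measurable_norm_diff:
  fixes f g :: "'w \<Rightarrow> 'b::banach"
  assumes S: "separable_banach_subspace S"
    and [measurable]: "f \<in> borel_measurable P" "g \<in> borel_measurable P"
    and g: "\<And>\<omega>. \<omega> \<in> space P \<Longrightarrow> g \<omega> \<in> S"
  shows "(\<lambda>\<omega>. norm (f \<omega> - g \<omega>)) \<in> borel_measurable P"
proof -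
  obtain D where D: "countable D" "S \<subseteq> closure D" using S unfolding separable_banach_subspace_def by blast
  have [measurable]: "(\<lambda>\<omega>. dist (k \<omega>) d) \<in> borel_measurable P" if [measurable]: "k \<in> borel_measurable P" for d and k :: "'w \<Rightarrow> 'b"
    by (rule measurable_compose[OF that borel_measurable_continuous_onI]) (intro continuous_intros)
  have "(\<lambda>\<omega>. dist (f \<omega>) (g \<omega>)) \<in> borel_measurable P"
    unfolding borel_measurable_iff_less
  proof
    fix a
    have "{\<omega> \<in> space P. dist (f \<omega>) (g \<omega>) < a} = (\<Union>d\<in>D. {\<omega> \<in> space P. dist (f \<omega>) d + dist (g \<omega>) d < a})"
    proof (intro equalityI subsetI)
      fix \<omega> assume "\<omega> \<in> {\<omega> \<in> space P. dist (f \<omega>) (g \<omega>) < a}"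
      then have \<omega>: "\<omega> \<in> space P" and lt: "dist (f \<omega>) (g \<omega>) < a" by auto
      have "(a - dist (f \<omega>) (g \<omega>)) / 2 > 0" using lt by simp
      then obtain d where d: "d \<in> D" "dist d (g \<omega>) < (a - dist (f \<omega>) (g \<omega>)) / 2"
        using g[OF \<omega>] D(2) unfolding closure_approachable subset_iff by blast
      then have "dist d (g \<omega>) + dist d (g \<omega>) + dist (f \<omega>) (g \<omega>) < a" by (simp add: field_simps)
      then have "dist (f \<omega>) d + dist (g \<omega>) d < a"
        using dist_triangle[of "f \<omega>" d "g \<omega>"] by (simp add: dist_commute)
      then show "\<omega> \<in> (\<Union>d\<in>D. {\<omega> \<in> space P. dist (f \<omega>) d + dist (g \<omega>) d < a})" using d \<omega> by auto
    next
      fix \<omega> assume "\<omega> \<in> (\<Union>d\<in>D. {\<omega> \<in> space P. dist (f \<omega>) d + dist (g \<omega>) d < a})"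
      then obtain d where "\<omega> \<in> space P" "dist (f \<omega>) d + dist (g \<omega>) d < a" by auto
      then show "\<omega> \<in> {\<omega> \<in> space P. dist (f \<omega>) (g \<omega>) < a}"
        using dist_triangle2[of "f \<omega>" "g \<omega>" d] by auto
    qed
    also have "\<dots> \<in> sets P" using D(1) by (intro sets.countable_UN'') measurable
    finally show "{\<omega> \<in> space P. dist (f \<omega>) (g \<omega>) < a} \<in> sets P" .
  qed
  then show ?thesis by (simp add: dist_norm)
qed

text \<open>For \<open>s = t\<close> the quotient in \<open>moment\<close> is
  \<open>0 / 0 = 0\<close> and \<open>\<Phi> 0 = 0\<close>, so the diagonal adds no
  constraint.\<close>

locale gauge_process = gauge + prob_space P for P :: "'w measure" +
  fixes S :: "'b::banach set" and X :: "real \<Rightarrow> 'w \<Rightarrow> 'b"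
  assumes S: "separable_banach_subspace S"
    and process: "process_on_unit P S X" and separable: "separable_process P X"
    and moment: "\<And>s t. s \<in> {0..1} \<Longrightarrow> t \<in> {0..1} \<Longrightarrow>
      (\<integral>\<^sup>+\<omega>. ennreal (\<Phi> (norm (X s \<omega> - X t \<omega>) / \<bar>s - t\<bar> powr \<alpha>)) \<partial>P) \<le> 1"
begin

abbreviation path :: "'w \<Rightarrow> real \<Rightarrow> 'b" where "path \<omega> t \<equiv> X t \<omega>"

lemma measurable_norm_increment [measurable]:
  "s \<in> {0..1} \<Longrightarrow> t \<in> {0..1} \<Longrightarrow> (\<lambda>\<omega>. norm (X s \<omega> - X t \<omega>)) \<in> borel_measurable P"
  using process unfolding process_on_unit_def by (intro borel_measurable_norm_diff[OF S]) auto

text \<open>\<open>\<Phi>\<close> is uncontrolled on negative reals; composing with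
  \<open>max 0\<close> gives a globally continuous function that agrees with it where
  needed.\<close>

lemma measurable_\<Phi>:
  assumes "f \<in> borel_measurable P" "\<And>\<omega>. f \<omega> \<ge> 0"
  shows "(\<lambda>\<omega>. \<Phi> (f \<omega>)) \<in> borel_measurable P"
proof -
  have "continuous_on UNIV (\<lambda>z. \<Phi> (max 0 z))"
    by (rule continuous_on_compose2[OF cont]) (auto intro!: continuous_intros)
  then have "(\<lambda>\<omega>. \<Phi> (max 0 (f \<omega>))) \<in> borel_measurable P"
    by (rule measurable_compose[OF assms(1) borel_measurable_continuous_onI])
  then show ?thesis using assms(2) by (simp add: max_absorb2)
qed

lemma measurable_\<psi>:
  assumes "f \<in> borel_measurable P" "\<And>\<omega>. f \<omega> \<ge> 0"
  shows "(\<lambda>\<omega>. \<psi> (f \<omega>)) \<in> borel_measurable P"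
proof -
  have "continuous_on UNIV (\<lambda>z. \<psi> (max 0 z))"
    by (rule continuous_on_compose2[OF continuous_\<psi>]) (auto intro!: continuous_intros)
  then have "(\<lambda>\<omega>. \<psi> (max 0 (f \<omega>))) \<in> borel_measurable P"
    by (rule measurable_compose[OF assms(1) borel_measurable_continuous_onI])
  then show ?thesis using assms(2) by (simp add: max_absorb2)
qed

lemma dy_mem: "l < 2 ^ n \<Longrightarrow> dy n l \<in> {0..1} \<and> dy n (Suc l) \<in> {0..1}"
  using dy_le_one[of l n] dy_le_one[of "Suc l" n] by auto

lemma measurable_excess:
  assumes "K > 0" "l < 2 ^ n"
  shows "(\<lambda>\<omega>. excess K (path \<omega>) n l) \<in> borel_measurable P"
proof -
  have m [measurable]: "(\<lambda>\<omega>. incr K (path \<omega>) n l) \<in> borel_measurable P"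
    unfolding incr_def using dy_mem[OF assms(2)]
    by (intro borel_measurable_divide borel_measurable_times borel_measurable_const measurable_norm_increment) auto
  have [measurable]: "(\<lambda>\<omega>. \<Phi> (incr K (path \<omega>) n l)) \<in> borel_measurable P"
    using assms(1) by (intro measurable_\<Phi> m) (simp add: incr_def)
  show ?thesis unfolding excess_def by measurable
qed

lemma level_excess_unit:
  "level_excess K x 0 1 n = weight (Suc n) / 2 ^ n * (\<Sum>l<2^n. excess K x n l)"
  unfolding level_excess_def using dy_mem[of _ n]
  by (intro arg_cong2[where f = "(*)"] refl sum.cong) auto

lemma measurable_level_excess:
  "K > 0 \<Longrightarrow> (\<lambda>\<omega>. level_excess K (path \<omega>) 0 1 n) \<in> borel_measurable P"
  unfolding level_excess_unit
  by (intro borel_measurable_times borel_measurable_const borel_measurable_sum measurable_excess) auto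

section \<open>First moment of the excess and Markov's inequality\<close>

lemma nn_integral_excess_le:
  assumes "M \<ge> 1" "l < 2 ^ n"
  shows "(\<integral>\<^sup>+\<omega>. ennreal (excess (R\<^sup>2 * M) (path \<omega>) n l) \<partial>P) \<le> ennreal (1 / \<Phi> M)"
proof -
  define s t where "s = dy n (Suc l)" and "t = dy n l"
  have st: "s \<in> {0..1}" "t \<in> {0..1}" using dy_mem[OF assms(2)] by (auto simp: s_def t_def)
  have PM: "\<Phi> M > 0" using assms by (intro pos) auto
  have R2: "R\<^sup>2 > 0" using R_gt by simp
  have dist: "\<bar>s - t\<bar> powr \<alpha> = 1 / (2 powr \<alpha>) ^ n"
  proof -
    have "\<bar>s - t\<bar> = 1 / 2 ^ n" by (simp add: s_def t_def dy_Suc)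
    then have "\<bar>s - t\<bar> powr \<alpha> = 1 powr \<alpha> / (2 ^ n) powr \<alpha>" by (simp only: powr_divide)
    also have "(2 ^ n) powr \<alpha> = (2 powr \<alpha>) ^ n" by (simp add: powr_power powr_powr mult.commute flip: powr_realpow)
    finally show ?thesis by simp
  qed
  have "excess (R\<^sup>2 * M) (path \<omega>) n l \<le> 1 / \<Phi> M * \<Phi> (norm (X s \<omega> - X t \<omega>) / \<bar>s - t\<bar> powr \<alpha>)" for \<omega>
  proof -
    define z where "z = incr (R\<^sup>2 * M) (path \<omega>) n l"
    have z: "R\<^sup>2 * z * M = norm (X s \<omega> - X t \<omega>) / \<bar>s - t\<bar> powr \<alpha>"
      unfolding z_def incr_def dist using R2 assms by (simp add: s_def t_def)
    show ?thesis
    proof (cases "z \<ge> 1")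
      case True
      then have "\<Phi> z * \<Phi> M \<le> \<Phi> (R\<^sup>2 * z * M)" using assms by (intro supermult)
      then show ?thesis using True PM unfolding z by (simp add: excess_def z_def field_simps)
    next
      case False
      have "0 \<le> \<Phi> (norm (X s \<omega> - X t \<omega>) / \<bar>s - t\<bar> powr \<alpha>)" by (intro nonneg) simp
      then show ?thesis using False PM by (simp add: excess_def z_def)
    qed
  qed
  then have "(\<integral>\<^sup>+\<omega>. ennreal (excess (R\<^sup>2 * M) (path \<omega>) n l) \<partial>P) \<le>
    (\<integral>\<^sup>+\<omega>. ennreal (1 / \<Phi> M) * ennreal (\<Phi> (norm (X s \<omega> - X t \<omega>) / \<bar>s - t\<bar> powr \<alpha>)) \<partial>P)"
    using PM by (intro nn_integral_mono) (simp add: ennreal_leI nonneg flip: ennreal_mult)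
  also have "\<dots> = ennreal (1 / \<Phi> M) * (\<integral>\<^sup>+\<omega>. ennreal (\<Phi> (norm (X s \<omega> - X t \<omega>) / \<bar>s - t\<bar> powr \<alpha>)) \<partial>P)"
    using st by (intro nn_integral_cmult measurable_compose[OF measurable_\<Phi> measurable_ennreal]) auto
  also have "\<dots> \<le> ennreal (1 / \<Phi> M) * 1"
    using st by (intro mult_left_mono moment) auto
  finally show ?thesis by simp
qed

text \<open>Taken in \<open>ennreal\<close>, so that measurability and the exchange of sum and
  integral need no prior summability.\<close>

definition total_excess :: "real \<Rightarrow> 'w \<Rightarrow> ennreal" where
  "total_excess K \<omega> = (\<Sum>n. ennreal (level_excess K (path \<omega>) 0 1 n))"

lemma measurable_total_excess: "K > 0 \<Longrightarrow> total_excess K \<in> borel_measurable P"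
proof -
  assume "K > 0"
  then have [measurable]: "(\<lambda>\<omega>. level_excess K (path \<omega>) 0 1 n) \<in> borel_measurable P" for n
    by (rule measurable_level_excess)
  show ?thesis unfolding total_excess_def[abs_def] by measurable
qed

definition weight_sum :: real where
  "weight_sum = (\<Sum>n. weight (Suc n))"

lemma weight_sum_nonneg: "weight_sum \<ge> 0"
  unfolding weight_sum_def using summable_weight weight_pos
  by (intro suminf_nonneg) (auto simp: summable_Suc_iff less_imp_le)

text \<open>The \<open>2 ^ n\<close> intervals of level \<open>n\<close> cancel the factor
  \<open>1 / 2 ^ n\<close>, and what remains is the summable sequence of weights.\<close>

lemma nn_integral_total_excess_le:
  assumes M: "M \<ge> 1"
  shows "(\<integral>\<^sup>+\<omega>. total_excess (R\<^sup>2 * M) \<omega> \<partial>P) \<le> ennreal (weight_sum / \<Phi> M)"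
proof -
  have K: "R\<^sup>2 * M > 0" using M R_gt by simp
  have PM: "\<Phi> M > 0" using M by (intro pos) auto
  have level: "(\<integral>\<^sup>+\<omega>. ennreal (level_excess (R\<^sup>2 * M) (path \<omega>) 0 1 n) \<partial>P) \<le> ennreal (weight (Suc n) / \<Phi> M)" for n
  proof -
    have w: "weight (Suc n) / 2 ^ n \<ge> 0" using weight_pos[of "Suc n"] by simp
    have meas: "(\<lambda>\<omega>. ennreal (excess (R\<^sup>2 * M) (path \<omega>) n l)) \<in> borel_measurable P" if "l < 2 ^ n" for l
      by (rule measurable_compose[OF measurable_excess[OF K that] measurable_ennreal])
    have "(\<integral>\<^sup>+\<omega>. ennreal (level_excess (R\<^sup>2 * M) (path \<omega>) 0 1 n) \<partial>P) =
      (\<integral>\<^sup>+\<omega>. ennreal (weight (Suc n) / 2 ^ n) * (\<Sum>l<2^n. ennreal (excess (R\<^sup>2 * M) (path \<omega>) n l)) \<partial>P)"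
      unfolding level_excess_unit
      by (intro nn_integral_cong, subst sum_ennreal)
         (auto intro!: ennreal_mult w sum_nonneg excess_nonneg simp del: times_divide_eq_left)
    also have "\<dots> = ennreal (weight (Suc n) / 2 ^ n) * (\<Sum>l<2^n. \<integral>\<^sup>+\<omega>. ennreal (excess (R\<^sup>2 * M) (path \<omega>) n l) \<partial>P)"
    proof (subst nn_integral_cmult)
      show "(\<lambda>\<omega>. \<Sum>l<2^n. ennreal (excess (R\<^sup>2 * M) (path \<omega>) n l)) \<in> borel_measurable P"
        using meas by (intro borel_measurable_sum) auto
      show "ennreal (weight (Suc n) / 2 ^ n) * (\<integral>\<^sup>+\<omega>. (\<Sum>l<2^n. ennreal (excess (R\<^sup>2 * M) (path \<omega>) n l)) \<partial>P) =
        ennreal (weight (Suc n) / 2 ^ n) * (\<Sum>l<2^n. \<integral>\<^sup>+\<omega>. ennreal (excess (R\<^sup>2 * M) (path \<omega>) n l) \<partial>P)"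
        using meas by (subst nn_integral_sum) auto
    qed
    also have "\<dots> \<le> ennreal (weight (Suc n) / 2 ^ n) * (\<Sum>l<(2::nat)^n. ennreal (1 / \<Phi> M))"
      using nn_integral_excess_le[OF M] by (intro mult_left_mono sum_mono) auto
    also have "\<dots> = ennreal (weight (Suc n) / 2 ^ n) * ennreal (\<Sum>l<(2::nat)^n. 1 / \<Phi> M)"
      using PM by (subst sum_ennreal) auto
    also have "\<dots> = ennreal (weight (Suc n) / 2 ^ n * (\<Sum>l<(2::nat)^n. 1 / \<Phi> M))"
      using w by (intro ennreal_mult[symmetric] sum_nonneg) (use PM in auto)
    also have "weight (Suc n) / 2 ^ n * (\<Sum>l<(2::nat)^n. 1 / \<Phi> M) = weight (Suc n) / \<Phi> M" by simp
    finally show ?thesis .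
  qed
  have "(\<integral>\<^sup>+\<omega>. total_excess (R\<^sup>2 * M) \<omega> \<partial>P) = (\<Sum>n. \<integral>\<^sup>+\<omega>. ennreal (level_excess (R\<^sup>2 * M) (path \<omega>) 0 1 n) \<partial>P)"
    unfolding total_excess_def
    by (intro nn_integral_suminf measurable_compose[OF measurable_level_excess[OF K] measurable_ennreal])
  also have "\<dots> \<le> (\<Sum>n. ennreal (weight (Suc n) / \<Phi> M))"
    by (intro suminf_le level) auto
  also have "\<dots> = ennreal (\<Sum>n. weight (Suc n) / \<Phi> M)"
    using summable_weight weight_pos PM
    by (intro suminf_ennreal2 summable_divide) (auto simp: summable_Suc_iff less_imp_le)
  also have "(\<Sum>n. weight (Suc n) / \<Phi> M) = weight_sum / \<Phi> M"
    unfolding weight_sum_def using summable_weight by (intro suminf_divide) (simp add: summable_Suc_iff)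
  finally show ?thesis .
qed

lemma tame_of_total_excess:
  assumes "\<not> 1 \<le> 2 * total_excess K \<omega>"
  shows "tame K (path \<omega>)"
proof -
  have "total_excess K \<omega> \<noteq> top"
  proof
    assume "total_excess K \<omega> = top"
    then have "2 * total_excess K \<omega> = top" by (simp add: ennreal_mult_eq_top_iff)
    with assms show False by simp
  qed
  then obtain r where r: "total_excess K \<omega> = ennreal r" "r \<ge> 0" by (cases "total_excess K \<omega>") auto
  then have sm: "summable (level_excess K (path \<omega>) 0 1)"
    by (intro summable_suminf_not_top level_excess_nonneg) (simp add: total_excess_def)
  then have "ennreal (suminf (level_excess K (path \<omega>) 0 1)) = ennreal r"
    using r unfolding total_excess_def by (subst (asm) suminf_ennreal2) (auto simp: level_excess_nonneg)
  then have eq: "suminf (level_excess K (path \<omega>) 0 1) = r"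
    using r suminf_nonneg[OF sm level_excess_nonneg] by (simp add: ennreal_inj)
  have "\<not> ennreal 1 \<le> ennreal (2 * r)" using assms r by (simp add: ennreal_mult)
  then have "2 * r < 1" using r by (simp add: ennreal_le_iff del: ennreal_1)
  then show ?thesis unfolding tame_def eq using sm by simp
qed

definition wild :: "real \<Rightarrow> 'w set" where
  "wild M = {\<omega> \<in> space P. 1 \<le> 2 * total_excess (R\<^sup>2 * M) \<omega>}"

lemma sets_wild: "M \<ge> 1 \<Longrightarrow> wild M \<in> sets P"
proof -
  assume "M \<ge> 1"
  then have [measurable]: "total_excess (R\<^sup>2 * M) \<in> borel_measurable P"
    using R_gt by (intro measurable_total_excess) simp
  show ?thesis unfolding wild_def by measurable
qed

lemma emeasure_wild_le:
  assumes M: "M \<ge> 1"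
  shows "emeasure P (wild M) \<le> ennreal (2 * weight_sum / \<Phi> M)"
proof -
  have K: "R\<^sup>2 * M > 0" using M R_gt by simp
  have PM: "\<Phi> M > 0" using M by (intro pos) auto
  have "emeasure P (wild M) \<le> 2 * (\<integral>\<^sup>+\<omega>. total_excess (R\<^sup>2 * M) \<omega> * indicator (space P) \<omega> \<partial>P)"
    unfolding wild_def
    by (rule nn_integral_Markov_inequality) (use measurable_total_excess[OF K] in auto)
  also have "\<dots> = 2 * (\<integral>\<^sup>+\<omega>. total_excess (R\<^sup>2 * M) \<omega> \<partial>P)"
    by (intro arg_cong2[where f = "(*)"] refl nn_integral_cong) auto
  also have "\<dots> \<le> 2 * ennreal (weight_sum / \<Phi> M)"
    by (intro mult_left_mono nn_integral_total_excess_le M) auto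
  also have "\<dots> = ennreal (2 * weight_sum / \<Phi> M)"
    using PM weight_sum_nonneg by (simp add: ennreal_mult[symmetric] flip: ennreal_numeral)
  finally show ?thesis .
qed

section \<open>Almost sure continuity of the paths\<close>

text \<open>Continuity needs tameness only at some scale. The paths wild at all scales
  \<open>Suc m\<close> form a null set, because
  \<open>\<Phi> (real (Suc m)) \<ge> real (Suc m)\<close> sends the Markov bounds to 0.\<close>

lemma AE_eventually_tame: "AE \<omega> in P. \<exists>K>0. tame K (path \<omega>)"
proof -
  define N where "N = (\<Inter>m. wild (real (Suc m)))"
  have sets: "N \<in> sets P" unfolding N_def using sets_wild by (intro sets.countable_INT) auto
  have "emeasure P N \<le> ennreal (2 * weight_sum / real (Suc m))" for m
  proof -
    have "emeasure P N \<le> emeasure P (wild (real (Suc m)))"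
      unfolding N_def by (intro emeasure_mono sets_wild) auto
    also have "\<dots> \<le> ennreal (2 * weight_sum / \<Phi> (real (Suc m)))"
      by (rule emeasure_wild_le) simp
    also have "\<dots> \<le> ennreal (2 * weight_sum / real (Suc m))"
    proof -
      have "\<Phi> 1 \<le> 1 / real (Suc m) * \<Phi> (real (Suc m))" using scale_le[of "1 / real (Suc m)" "real (Suc m)"] by simp
      then have "real (Suc m) \<le> \<Phi> (real (Suc m))" using one by (simp add: field_simps)
      then show ?thesis using weight_sum_nonneg
        by (intro ennreal_leI divide_left_mono) (auto intro!: mult_pos_pos pos)
    qed
    finally show ?thesis .
  qed
  moreover have "(\<lambda>m. 2 * weight_sum * (1 / real (Suc m))) \<longlonglongrightarrow> 2 * weight_sum * 0"
    by (intro tendsto_intros LIMSEQ_Suc lim_1_over_n)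
  then have "(\<lambda>m. ennreal (2 * weight_sum / real (Suc m))) \<longlonglongrightarrow> ennreal 0"
    by (intro tendsto_ennrealI) simp
  ultimately have "emeasure P N \<le> ennreal 0"
    by (intro LIMSEQ_le_const) auto
  then have "N \<in> null_sets P" using sets by (auto simp: null_sets_def)
  then show ?thesis
  proof (rule AE_I')
    show "{\<omega> \<in> space P. \<not> (\<exists>K>0. tame K (path \<omega>))} \<subseteq> N"
    proof
      fix \<omega> assume \<omega>: "\<omega> \<in> {\<omega> \<in> space P. \<not> (\<exists>K>0. tame K (path \<omega>))}"
      have "\<omega> \<in> wild (real (Suc m))" for m
      proof (rule ccontr)
        assume "\<omega> \<notin> wild (real (Suc m))"
        then have "tame (R\<^sup>2 * real (Suc m)) (path \<omega>)" using \<omega> by (intro tame_of_total_excess) (auto simp: wild_def)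
        moreover have "R\<^sup>2 * real (Suc m) > 0" using R_gt by simp
        ultimately show False using \<omega> by blast
      qed
      then show "\<omega> \<in> N" by (simp add: N_def)
    qed
  qed
qed

text \<open>The distance to the rounded point is at most \<open>2^-n\<close>, so the expected
  increment is at most \<open>2 * b ^ n\<close>; the increments are then almost surely
  summable.\<close>

lemma AE_tendsto_dyadic:
  assumes t: "t \<in> {0..1}"
  shows "AE \<omega> in P. (\<lambda>n. X (dy n (dy_below n t)) \<omega>) \<longlonglongrightarrow> X t \<omega>"
proof -
  define d where "d n = dy n (dy_below n t)" for n
  have d: "d n \<in> {0..1}" "\<bar>d n - t\<bar> \<le> 1 / 2 ^ n" for n
    unfolding d_def using t dy_le_one[OF dy_below_le] dy_dy_below[of t n] by auto
  define f where "f n \<omega> = norm (X (d n) \<omega> - X t \<omega>)" for n \<omega>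
  have meas: "f n \<in> borel_measurable P" for n unfolding f_def[abs_def] using d t by (intro measurable_norm_increment)
  define b where "b = (1 / 2 :: real) powr \<alpha>"
  have b: "0 < b" "b < 1" unfolding b_def using \<alpha> powr01_less_one[of "1/2" \<alpha>] by auto
  have int: "(\<integral>\<^sup>+\<omega>. ennreal (f n \<omega>) \<partial>P) \<le> ennreal (2 * b ^ n)" for n
  proof -
    define g where "g \<omega> = \<Phi> (norm (X (d n) \<omega> - X t \<omega>) / \<bar>d n - t\<bar> powr \<alpha>)" for \<omega>
    have g: "g \<omega> \<ge> 0" for \<omega> unfolding g_def by (intro nonneg) auto
    have mg: "g \<in> borel_measurable P"
      unfolding g_def[abs_def] using d t by (intro measurable_\<Phi> borel_measurable_divide measurable_norm_increment) auto
    have "\<bar>d n - t\<bar> powr \<alpha> \<le> (1 / 2 ^ n) powr \<alpha>" using d \<alpha> by (intro powr_mono2) auto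
    also have "1 / 2 ^ n = (1 / 2 :: real) ^ n" by (simp add: power_one_over)
    also have "((1 / 2) ^ n) powr \<alpha> = b ^ n" unfolding b_def by (simp add: powr_power powr_powr mult.commute flip: powr_realpow)
    finally have dn: "\<bar>d n - t\<bar> powr \<alpha> \<le> b ^ n" .
    have "f n \<omega> \<le> b ^ n * (1 + g \<omega>)" for \<omega>
    proof (cases "d n = t")
      case True
      then show ?thesis using b g[of \<omega>] by (simp add: f_def)
    next
      case False
      then have p: "\<bar>d n - t\<bar> powr \<alpha> > 0" by simp
      have "f n \<omega> = \<bar>d n - t\<bar> powr \<alpha> * (f n \<omega> / \<bar>d n - t\<bar> powr \<alpha>)" using p by simp
      also have "\<dots> \<le> b ^ n * (1 + g \<omega>)"
        unfolding g_def f_def using b by (intro mult_mono dn le_one_plus) auto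
      finally show ?thesis .
    qed
    then have "(\<integral>\<^sup>+\<omega>. ennreal (f n \<omega>) \<partial>P) \<le> (\<integral>\<^sup>+\<omega>. ennreal (b ^ n) * (1 + ennreal (g \<omega>)) \<partial>P)"
      using b g by (intro nn_integral_mono) (simp add: ennreal_leI flip: ennreal_mult ennreal_plus ennreal_1)
    also have "\<dots> = ennreal (b ^ n) * (1 + (\<integral>\<^sup>+\<omega>. ennreal (g \<omega>) \<partial>P))"
      using mg by (simp add: nn_integral_cmult nn_integral_add emeasure_space_1)
    also have "\<dots> \<le> ennreal (b ^ n) * (1 + 1)"
      unfolding g_def using d t by (intro mult_left_mono add_left_mono moment) auto
    also have "\<dots> = ennreal (2 * b ^ n)"
      using b by (simp add: ennreal_mult mult.commute)
    finally show ?thesis .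
  qed
  have "(\<integral>\<^sup>+\<omega>. (\<Sum>n. ennreal (f n \<omega>)) \<partial>P) = (\<Sum>n. \<integral>\<^sup>+\<omega>. ennreal (f n \<omega>) \<partial>P)"
    using meas by (intro nn_integral_suminf) auto
  also have "\<dots> \<le> (\<Sum>n. ennreal (2 * b ^ n))" by (intro suminf_le int) auto
  also have "\<dots> = ennreal (\<Sum>n. 2 * b ^ n)"
    using b by (intro suminf_ennreal2 summable_mult summable_geometric) auto
  also have "\<dots> < \<infinity>" by simp
  finally have "AE \<omega> in P. (\<Sum>n. ennreal (f n \<omega>)) \<noteq> \<infinity>"
    using meas by (intro nn_integral_PInf_AE) auto
  then show ?thesis
  proof eventually_elim
    case (elim \<omega>)
    then have "summable (\<lambda>n. f n \<omega>)" by (intro summable_suminf_not_top) (auto simp: f_def)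
    then have "(\<lambda>n. f n \<omega>) \<longlonglongrightarrow> 0" by (rule summable_LIMSEQ_zero)
    then show ?case unfolding f_def d_def by (simp add: tendsto_norm_zero_iff LIM_zero_iff)
  qed
qed

text \<open>Convergence along dyadics holds off a null set depending on \<open>t\<close>;
  countability of the separating set \<open>T\<close> merges these into one.\<close>

lemma AE_continuous: "AE \<omega> in P. continuous_on {0..1} (path \<omega>)"
proof -
  obtain T where T: "countable T" "T \<subseteq> {0..1}" and sep: "AE \<omega> in P. \<forall>t\<in>{0..1}. \<forall>\<epsilon>>0.
          X t \<omega> \<in> closure ((\<lambda>s. X s \<omega>) ` {s\<in>T. \<bar>s - t\<bar> < \<epsilon>})"
    using separable unfolding separable_process_def by blast
  have "AE \<omega> in P. \<forall>t\<in>T. (\<lambda>n. X (dy n (dy_below n t)) \<omega>) \<longlonglongrightarrow> X t \<omega>"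
    using T by (subst AE_ball_countable) (auto intro: AE_tendsto_dyadic)
  with sep AE_eventually_tame show ?thesis
  proof eventually_elim
    case (elim \<omega>)
    then obtain K where "K > 0" "tame K (path \<omega>)" by blast
    then show ?case using elim T(2) by (intro tame_continuous[where T = T]) auto
  qed
qed

lemma tail_bound:
  fixes M :: real
  defines "E \<equiv> {\<omega> \<in> space P. psi_var \<psi> (path \<omega>) > ereal M}"
  assumes M: "M > 0"
  shows "E \<in> sets (completion P)"
    and "measure (completion P) E \<le> (2 * weight_sum + 1) / \<Phi> (1 / (R\<^sup>2 * chain_const) * M)"
proof -
  obtain N where N: "N \<in> null_sets P" "{\<omega> \<in> space P. \<not> continuous_on {0..1} (path \<omega>)} \<subseteq> N"
    using AE_continuous unfolding eventually_ae_filter by blast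
  then have cont: "continuous_on {0..1} (path \<omega>)" if "\<omega> \<in> space P - N" for \<omega> using that by auto
  define V where "V q n js \<omega> = (\<Sum>i<length js - 1. \<psi> (norm (X (dy n (js ! Suc i)) \<omega> - X (dy n (js ! i)) \<omega>) / of_rat q))"
    for q :: rat and n and js :: "nat list" and \<omega>
  \<comment> \<open>A countable union of measurable events that agrees with \<open>E\<close> off the
    null set \<open>N\<close>, by \<open>psi_var_gt_iff\<close>; hence \<open>E\<close> lies in the
    completion.\<close>
  define E' where "E' = {\<omega> \<in> space P. \<exists>(q::rat) (n::nat) (js::nat list). of_rat q > M \<and> js \<noteq> [] \<and>
      sorted_wrt (<) js \<and> set js \<subseteq> {..2 ^ n} \<and> V q n js \<omega> > 1}"
  have E'_sets: "E' \<in> sets P"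
  proof -
    have "{\<omega> \<in> space P. of_rat q > M \<and> js \<noteq> [] \<and> sorted_wrt (<) js \<and> set js \<subseteq> {..2 ^ n} \<and> V q n js \<omega> > 1} \<in> sets P"
      for q :: rat and n and js :: "nat list"
    proof (cases "of_rat q > M \<and> js \<noteq> [] \<and> sorted_wrt (<) js \<and> set js \<subseteq> {..2 ^ n}")
      case True
      have q: "of_rat q > (0::real)" using True M by linarith
      have js: "dy n (js ! i) \<in> {0..1}" if "i < length js" for i
      proof -
        have "js ! i \<le> 2 ^ n" using True nth_mem[OF that] by blast
        then show ?thesis by (simp add: dy_le_one)
      qed
      have [measurable]: "V q n js \<in> borel_measurable P"
        unfolding V_def[abs_def] using q js
        by (intro borel_measurable_sum measurable_\<psi> borel_measurable_divide measurable_norm_increment) auto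
      have "{\<omega> \<in> space P. V q n js \<omega> > 1} \<in> sets P" by measurable
      then show ?thesis using True by simp
    next
      case False
      then have "{\<omega> \<in> space P. of_rat q > M \<and> js \<noteq> [] \<and> sorted_wrt (<) js \<and> set js \<subseteq> {..2 ^ n} \<and> V q n js \<omega> > 1} = {}"
        by blast
      then show ?thesis by (simp only: sets.empty_sets)
    qed
    then show ?thesis unfolding E'_def by (intro sets.sets_Collect_countable_Ex)
  qed
  have eq: "\<omega> \<in> E \<longleftrightarrow> \<omega> \<in> E'" if "\<omega> \<in> space P - N" for \<omega>
    using psi_var_gt_iff[OF cont[OF that] M] that by (simp add: E_def E'_def V_def)
  have sub: "E \<subseteq> space P" "E' \<subseteq> space P" by (auto simp: E_def E'_def)
  show sets: "E \<in> sets (completion P)"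
  proof (rule sets_completionI)
    show "E = (E' - N) \<union> (E \<inter> N)" using eq sub by blast
    show "E' - N \<in> sets P" using E'_sets N by auto
  qed (use N in auto)
  interpret C: prob_space "completion P" by (rule prob_space_completion)
  \<comment> \<open>Chosen so that \<open>R^2 * m * chain_const = M\<close>: a path that is tame at
    scale \<open>R^2 * m\<close> has variation at most \<open>M\<close>.\<close>
  define m where "m = 1 / (R\<^sup>2 * chain_const) * M"
  have R2: "R\<^sup>2 > 0" using R_gt by simp
  have m: "m > 0" unfolding m_def using M R2 chain_const_pos by simp
  have "measure (completion P) E \<le> (2 * weight_sum + 1) / \<Phi> m"
  proof (cases "m \<ge> 1")
    case True
    have "E \<subseteq> wild m \<union> N"
    proof
      fix \<omega> assume \<omega>: "\<omega> \<in> E"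
      show "\<omega> \<in> wild m \<union> N"
      proof (rule ccontr)
        assume no: "\<omega> \<notin> wild m \<union> N"
        then have "tame (R\<^sup>2 * m) (path \<omega>)" using \<omega> sub by (intro tame_of_total_excess) (auto simp: wild_def)
        then have "psi_var \<psi> (path \<omega>) \<le> ereal (R\<^sup>2 * m * chain_const)"
          using no \<omega> sub R2 m by (intro psi_var_le cont) auto
        also have "R\<^sup>2 * m * chain_const = M" unfolding m_def using R2 chain_const_pos by simp
        finally show False using \<omega> unfolding E_def by (auto dest: leD)
      qed
    qed
    then have "measure (completion P) E \<le> measure (completion P) (wild m \<union> N)"
      using sets_wild[OF True] N by (intro C.finite_measure_mono) auto
    also have "\<dots> = measure P (wild m \<union> N)" using sets_wild[OF True] N by (intro measure_completion) auto
    also have "\<dots> = measure P (wild m)"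
      using sets_wild[OF True] N by (simp add: measure_Un_null_set)
    also have "\<dots> \<le> 2 * weight_sum / \<Phi> m"
      using emeasure_wild_le[OF True] weight_sum_nonneg pos[OF m] unfolding emeasure_eq_measure
      by (subst (asm) ennreal_le_iff) auto
    also have "\<dots> \<le> (2 * weight_sum + 1) / \<Phi> m" using pos[OF m] by (intro divide_right_mono) auto
    finally show ?thesis .
  next
    case False
    then have "\<Phi> m \<le> 1" using mono[of m 1] m one by simp
    then have "1 \<le> (2 * weight_sum + 1) / \<Phi> m" using pos[OF m] weight_sum_nonneg by (simp add: pos_le_divide_eq)
    then show ?thesis using C.prob_le_1[of E] by linarith
  qed
  then show "measure (completion P) E \<le> (2 * weight_sum + 1) / \<Phi> (1 / (R\<^sup>2 * chain_const) * M)" by (simp only: m_def)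
qed

end

text \<open>The partition \<open>0 < 1\<close> alone shows that the variation is at least
  \<open>|X_1 - X_0| / \<Phi>inv (h 1)\<close>. For exponentially growing \<open>\<Phi>\<close> such
  a scale factor cannot be absorbed into \<open>C\<close>, which is why \<open>c\<close> is fixed
  after a lower bound \<open>\<eta>\<close> for \<open>h 1\<close> and is uniform over all such
  \<open>h\<close>.\<close>

theorem theorem3p3:
  fixes \<Phi> \<phi> :: "real \<Rightarrow> real" and R \<alpha> :: real and n\<^sub>0 :: nat
  assumes "convex_self_homeo \<Phi>" and "convex_self_homeo \<phi>"
    and "\<Phi> 1 = 1" and "\<phi> 1 = 1"
    and "R > 1" and "n\<^sub>0 \<ge> 1"
    and "\<And>x y. x \<ge> 1 \<Longrightarrow> y \<ge> 1 \<Longrightarrow> \<Phi> x * \<Phi> y \<le> \<Phi> (R\<^sup>2 * x * y)"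
    and "\<And>k::nat. k \<ge> 1 \<Longrightarrow> \<phi> (R ^ k) / \<phi> (R ^ (k + 1)) \<le> \<phi> (R ^ (k - 1)) / \<phi> (R ^ k)"
    and "summable (\<lambda>k. \<phi> (R ^ k) / \<Phi> (R ^ (k + n\<^sub>0)))"
    and "0 < \<alpha>" and "\<alpha> \<le> 1"
    and "(\<integral>\<^sup>+y\<in>{2..}. ennreal (ln y / \<Phi> (y powr \<alpha>)) \<partial>lborel) < \<infinity>"
  shows "\<forall>\<eta>>0. \<exists>c>0. \<forall>h::real \<Rightarrow> real.
    (\<forall>u>0. h u > 0) \<and> mono_on {0<..} h \<and> continuous_on {0<..} h \<and>
    (\<integral>\<^sup>+u\<in>{1..}. ennreal (1 / h u) \<partial>lborel) < \<infinity> \<and>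
    strict_mono_on {0<..} (sigma_fn \<Phi> \<alpha> h) \<and> (sigma_fn \<Phi> \<alpha> h \<longlongrightarrow> 0) (at_right 0) \<and>
    h 1 \<ge> \<eta>
    \<longrightarrow> (\<exists>C>0. \<forall>(P::'w measure) (S::'b::banach set) X.
          prob_space P \<and> separable_banach_subspace S \<and>
          process_on_unit P S X \<and> separable_process P X \<and>
          (\<forall>s\<in>{0..1}. \<forall>t\<in>{0..1}.
             (\<integral>\<^sup>+\<omega>. ennreal (\<Phi> (norm (X s \<omega> - X t \<omega>) / \<bar>s - t\<bar> powr \<alpha>)) \<partial>P) \<le> 1)
          \<longrightarrow> (\<forall>M>0.
                {\<omega>\<in>space P. psi_var (psi_fn \<Phi> \<alpha> h) (\<lambda>t. X t \<omega>) > ereal M} \<in> sets (completion P) \<and>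
                measure (completion P)
                  {\<omega>\<in>space P. psi_var (psi_fn \<Phi> \<alpha> h) (\<lambda>t. X t \<omega>) > ereal M} \<le> C / \<Phi> (c * M)))"
proof -
  interpret supermult_orlicz \<Phi> R
    by unfold_locales (fact assms)+
  obtain \<theta> \<rho> A where const: "0 < \<theta>" "\<theta> < 1" "0 < \<rho>" "\<rho> < 1" "0 < A"
      "\<And>k. \<Phi>inv ((2 / \<theta>) ^ k) \<le> A * (2 powr \<alpha> * \<rho>) ^ k"
    using \<Phi>inv_geometric[OF assms(10,12)] by blast
  show ?thesis
  proof (intro allI impI)
    fix \<eta> :: real assume \<eta>: "\<eta> > 0"
    \<comment> \<open>The value of \<open>chain_const\<close>, written out because \<open>c\<close>
      must be named before \<open>h\<close> is fixed and the locale \<open>gauge\<close> can be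
      interpreted. The function \<open>h\<close> itself enters only \<open>C\<close>, through the
      sum of its weights.\<close>
    define \<kappa> where "\<kappa> = 2 * max (R\<^sup>2) (1 / \<Phi>inv \<eta>) * A * (2 powr \<alpha>)\<^sup>2 / (1 - \<rho>)"
    have "\<kappa> > 0" unfolding \<kappa>_def using const R_gt
      by (intro divide_pos_pos mult_pos_pos) (auto simp: less_max_iff_disj)
    then have c: "1 / (R\<^sup>2 * \<kappa>) > 0" using R_gt by simp
    show "\<exists>c>0. \<forall>h::real \<Rightarrow> real.
      (\<forall>u>0. h u > 0) \<and> mono_on {0<..} h \<and> continuous_on {0<..} h \<and>
      (\<integral>\<^sup>+u\<in>{1..}. ennreal (1 / h u) \<partial>lborel) < \<infinity> \<and>
      strict_mono_on {0<..} (sigma_fn \<Phi> \<alpha> h) \<and> (sigma_fn \<Phi> \<alpha> h \<longlongrightarrow> 0) (at_right 0) \<and>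
      h 1 \<ge> \<eta>
      \<longrightarrow> (\<exists>C>0. \<forall>(P::'w measure) (S::'b::banach set) X.
            prob_space P \<and> separable_banach_subspace S \<and>
            process_on_unit P S X \<and> separable_process P X \<and>
            (\<forall>s\<in>{0..1}. \<forall>t\<in>{0..1}.
               (\<integral>\<^sup>+\<omega>. ennreal (\<Phi> (norm (X s \<omega> - X t \<omega>) / \<bar>s - t\<bar> powr \<alpha>)) \<partial>P) \<le> 1)
            \<longrightarrow> (\<forall>M>0.
                  {\<omega>\<in>space P. psi_var (psi_fn \<Phi> \<alpha> h) (\<lambda>t. X t \<omega>) > ereal M} \<in> sets (completion P) \<and>
                  measure (completion P)
                    {\<omega>\<in>space P. psi_var (psi_fn \<Phi> \<alpha> h) (\<lambda>t. X t \<omega>) > ereal M} \<le> C / \<Phi> (c * M)))"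
    proof (rule exI[of _ "1 / (R\<^sup>2 * \<kappa>)"], rule conjI[OF c], intro allI impI)
      fix h :: "real \<Rightarrow> real"
      assume h: "(\<forall>u>0. h u > 0) \<and> mono_on {0<..} h \<and> continuous_on {0<..} h \<and>
        (\<integral>\<^sup>+u\<in>{1..}. ennreal (1 / h u) \<partial>lborel) < \<infinity> \<and>
        strict_mono_on {0<..} (sigma_fn \<Phi> \<alpha> h) \<and> (sigma_fn \<Phi> \<alpha> h \<longlongrightarrow> 0) (at_right 0) \<and> h 1 \<ge> \<eta>"
      interpret gauge \<Phi> R \<alpha> h \<eta> \<theta> \<rho> A
        by unfold_locales (use h \<eta> const assms(10) in auto)
      define C where "C = 2 * (\<Sum>n. weight (Suc n)) + 1"
      have "(\<Sum>n. weight (Suc n)) \<ge> 0"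
        using summable_weight weight_pos by (intro suminf_nonneg) (auto simp: summable_Suc_iff less_imp_le)
      then have "C > 0" by (simp add: C_def)
      have \<kappa>: "chain_const = \<kappa>" by (simp only: chain_const_def \<kappa>_def)
      show "\<exists>C>0. \<forall>(P::'w measure) (S::'b set) X.
            prob_space P \<and> separable_banach_subspace S \<and>
            process_on_unit P S X \<and> separable_process P X \<and>
            (\<forall>s\<in>{0..1}. \<forall>t\<in>{0..1}.
               (\<integral>\<^sup>+\<omega>. ennreal (\<Phi> (norm (X s \<omega> - X t \<omega>) / \<bar>s - t\<bar> powr \<alpha>)) \<partial>P) \<le> 1)
            \<longrightarrow> (\<forall>M>0.
                  {\<omega>\<in>space P. psi_var \<psi> (\<lambda>t. X t \<omega>) > ereal M} \<in> sets (completion P) \<and>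
                  measure (completion P)
                    {\<omega>\<in>space P. psi_var \<psi> (\<lambda>t. X t \<omega>) > ereal M} \<le> C / \<Phi> (1 / (R\<^sup>2 * \<kappa>) * M))"
      proof (rule exI[of _ C], rule conjI[OF \<open>C > 0\<close>], intro allI impI)
        fix P :: "'w measure" and S :: "'b set" and X :: "real \<Rightarrow> 'w \<Rightarrow> 'b" and M :: real
        assume X: "prob_space P \<and> separable_banach_subspace S \<and>
          process_on_unit P S X \<and> separable_process P X \<and>
          (\<forall>s\<in>{0..1}. \<forall>t\<in>{0..1}.
             (\<integral>\<^sup>+\<omega>. ennreal (\<Phi> (norm (X s \<omega> - X t \<omega>) / \<bar>s - t\<bar> powr \<alpha>)) \<partial>P) \<le> 1)"
          and M: "M > 0"
        have "gauge_process \<Phi> R \<alpha> h \<eta> \<theta> \<rho> A P S X"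
          by (intro gauge_process.intro gauge_axioms gauge_process_axioms.intro) (use X in auto)
        then interpret gauge_process \<Phi> R \<alpha> h \<eta> \<theta> \<rho> A P S X .
        show "{\<omega>\<in>space P. psi_var \<psi> (\<lambda>t. X t \<omega>) > ereal M} \<in> sets (completion P) \<and>
          measure (completion P) {\<omega>\<in>space P. psi_var \<psi> (\<lambda>t. X t \<omega>) > ereal M} \<le> C / \<Phi> (1 / (R\<^sup>2 * \<kappa>) * M)"
          using tail_bound[OF M] unfolding weight_sum_def C_def \<kappa> by blast
      qed
    qed
  qed
qed

end
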